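(* Let $1\le p<\infty$ and $0<s<1$. Suppose that $\sigma:\mathbb{R}^N\to(0,\infty)$ is a screening function such that $0<\inf_{\mathbb{R}^N}\sigma\le\sup_{\mathbb{R}^N}\sigma<\infty$. Then $C^\infty(\mathbb{R}^N)\cap\tilde{W}^{s,p}_{(\sigma)}(\mathbb{R}^N)$ is dense in $\tilde{W}^{s,p}_{(\sigma)}(\mathbb{R}^N)$, and $\big(C^\infty(\mathbb{R}^N)\cap\tilde{W}^{s,p}_{(\sigma)}(\mathbb{R}^N)\big)/\mathbb{R}$ is dense in $\tilde{W}^{s,p}_{(\sigma)}(\mathbb{R}^N)/\mathbb{R}$.
   Context: A screening function on $\mathbb{R}^N$ is a lower semicontinuous function with values in $(0,\infty]$. For $f\in L^1_{\mathrm{loc}}(\mathbb{R}^N)$, $$|f|_{\tilde{W}^{s,p}_{(\sigma)}(\mathbb{R}^N)}:=\left(\int_{\mathbb{R}^N}\int_{B(0,\sigma(x))}\frac{|f(x+h)-f(x)|^p}{|h|^{sp+N}}\,dh\,dx\right)^{1/p},$$ and $\tilde{W}^{s,p}_{(\sigma)}(\mathbb{R}^N)$ is the space of $f\in L^1_{\mathrm{loc}}(\mathbb{R}^N)$ for which this seminorm is finite, with the seminorm topology. The quotient by $\mathbb{R}$ identifies functions differing a.e. by a constant; it is normed by $\|[f]\|:=|f|_{\tilde{W}^{s,p}_{(\sigma)}(\mathbb{R}^N)}$. *)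

theory Defs
  imports "HOL-Analysis.Analysis"
begin

section \<open>Smooth and locally integrable functions\<close>

text \<open>Recursion on the order: the directional derivatives along the standard basis are the
  first-order partial derivatives, and all of them are required to be of class \<open>C\<^sup>k\<close> again.\<close>

primrec cont_diff :: "nat \<Rightarrow> ('a::euclidean_space \<Rightarrow> real) \<Rightarrow> bool" where
  "cont_diff 0 f \<longleftrightarrow> continuous_on UNIV f"
| "cont_diff (Suc k) f \<longleftrightarrow>
     (\<forall>x. f differentiable (at x)) \<and>
     (\<forall>b\<in>Basis. cont_diff k (\<lambda>x. frechet_derivative f (at x) b))"

definition smooth_functions :: "('a::euclidean_space \<Rightarrow> real) set" where
  "smooth_functions = {f. \<forall>k. cont_diff k f}"

text \<open>Elements are genuine functions rather than almost-everywhere classes.\<close>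

definition L1_loc :: "('a::euclidean_space \<Rightarrow> real) set" where
  "L1_loc = {f. \<forall>K. compact K \<longrightarrow> set_integrable lebesgue K f}"

section \<open>Screened homogeneous fractional Sobolev spaces\<close>

definition screening_function :: "('a::euclidean_space \<Rightarrow> ennreal) \<Rightarrow> bool" where
  "screening_function \<sigma> \<longleftrightarrow> (\<forall>x. 0 < \<sigma> x) \<and> (\<forall>a. open {x. a < \<sigma> x})"

text \<open>The \<open>p\<close>-th power of the seminorm, possibly infinite. The set of integration for \<open>h\<close> is the
  ball \<open>B(0, \<sigma>(x))\<close>, which is the whole space if \<open>\<sigma>(x) = \<infinity>\<close>.\<close>

definition screened_energy ::
    "('a::euclidean_space \<Rightarrow> ennreal) \<Rightarrow> real \<Rightarrow> real \<Rightarrow> ('a \<Rightarrow> real) \<Rightarrow> ennreal" where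
  "screened_energy \<sigma> s p f =
     (\<integral>\<^sup>+x. (\<integral>\<^sup>+h\<in>{h. ennreal (norm h) < \<sigma> x}.
        ennreal (\<bar>f (x + h) - f x\<bar> powr p / norm h powr (s * p + real DIM('a))) \<partial>lebesgue) \<partial>lebesgue)"

text \<open>Only meaningful for functions of finite energy, since \<^const>\<open>enn2real\<close> sends \<open>\<infinity>\<close> to \<open>0\<close>.\<close>

definition screened_seminorm ::
    "('a::euclidean_space \<Rightarrow> ennreal) \<Rightarrow> real \<Rightarrow> real \<Rightarrow> ('a \<Rightarrow> real) \<Rightarrow> real" where
  "screened_seminorm \<sigma> s p f = enn2real (screened_energy \<sigma> s p f) powr (1 / p)"

definition screened_space ::
    "('a::euclidean_space \<Rightarrow> ennreal) \<Rightarrow> real \<Rightarrow> real \<Rightarrow> ('a \<Rightarrow> real) set" where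
  "screened_space \<sigma> s p = {f \<in> L1_loc. screened_energy \<sigma> s p f < \<infinity>}"

section \<open>Topology of a pseudometric\<close>

text \<open>\<^const>\<open>Metric_space.mtopology\<close> is only available for genuine metrics, whereas a seminorm
  need not separate points.\<close>

definition pseudometric_topology :: "'b set \<Rightarrow> ('b \<Rightarrow> 'b \<Rightarrow> real) \<Rightarrow> 'b topology" where
  "pseudometric_topology M d =
     topology (\<lambda>U. U \<subseteq> M \<and> (\<forall>x\<in>U. \<exists>e>0. \<forall>y\<in>M. d x y < e \<longrightarrow> y \<in> U))"

lemma openin_pseudometric_topology:
  "openin (pseudometric_topology M d) U \<longleftrightarrow>
     U \<subseteq> M \<and> (\<forall>x\<in>U. \<exists>e>0. \<forall>y\<in>M. d x y < e \<longrightarrow> y \<in> U)"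
proof -
  have "istopology (\<lambda>U. U \<subseteq> M \<and> (\<forall>x\<in>U. \<exists>e>0. \<forall>y\<in>M. d x y < e \<longrightarrow> y \<in> U))"
    unfolding istopology_def
  proof (rule conjI; intro allI impI)
    fix S T
    assume S: "S \<subseteq> M \<and> (\<forall>x\<in>S. \<exists>e>0. \<forall>y\<in>M. d x y < e \<longrightarrow> y \<in> S)"
      and T: "T \<subseteq> M \<and> (\<forall>x\<in>T. \<exists>e>0. \<forall>y\<in>M. d x y < e \<longrightarrow> y \<in> T)"
    have "\<exists>e>0. \<forall>y\<in>M. d x y < e \<longrightarrow> y \<in> S \<inter> T" if "x \<in> S \<inter> T" for x
    proof -
      obtain e1 where "e1 > 0" "\<forall>y\<in>M. d x y < e1 \<longrightarrow> y \<in> S" using S \<open>x \<in> S \<inter> T\<close> by blast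
      moreover obtain e2 where "e2 > 0" "\<forall>y\<in>M. d x y < e2 \<longrightarrow> y \<in> T"
        using T \<open>x \<in> S \<inter> T\<close> by blast
      ultimately show ?thesis by (intro exI[of _ "min e1 e2"]) auto
    qed
    then show "S \<inter> T \<subseteq> M \<and> (\<forall>x\<in>S \<inter> T. \<exists>e>0. \<forall>y\<in>M. d x y < e \<longrightarrow> y \<in> S \<inter> T)"
      using S by blast
  next
    fix \<K> :: "'a set set"
    assume K: "\<forall>U\<in>\<K>. U \<subseteq> M \<and> (\<forall>x\<in>U. \<exists>e>0. \<forall>y\<in>M. d x y < e \<longrightarrow> y \<in> U)"
    show "\<Union>\<K> \<subseteq> M \<and> (\<forall>x\<in>\<Union>\<K>. \<exists>e>0. \<forall>y\<in>M. d x y < e \<longrightarrow> y \<in> \<Union>\<K>)"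
    proof (intro conjI ballI)
      show "\<Union>\<K> \<subseteq> M" using K by blast
      fix x assume "x \<in> \<Union>\<K>"
      then obtain U where U: "U \<in> \<K>" "x \<in> U" by blast
      then obtain e where "e > 0" "\<forall>y\<in>M. d x y < e \<longrightarrow> y \<in> U" using K by meson
      then show "\<exists>e>0. \<forall>y\<in>M. d x y < e \<longrightarrow> y \<in> \<Union>\<K>" using U by blast
    qed
  qed
  then show ?thesis
    unfolding pseudometric_topology_def by (simp add: topology_inverse')
qed

lemma topspace_pseudometric_topology [simp]: "topspace (pseudometric_topology M d) = M"
proof -
  have "openin (pseudometric_topology M d) M"
    unfolding openin_pseudometric_topology by (auto intro: exI[of _ 1])
  moreover have "topspace (pseudometric_topology M d) \<subseteq> M"
    using openin_topspace[of "pseudometric_topology M d"]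
    unfolding openin_pseudometric_topology by (rule conjunct1)
  ultimately show ?thesis by (meson openin_subset subset_antisym)
qed

lemma pseudometric_topology_eq_mtopology:
  assumes "Metric_space M d"
  shows "pseudometric_topology M d = Metric_space.mtopology M d"
proof -
  interpret Metric_space M d by fact
  have "openin (pseudometric_topology M d) U \<longleftrightarrow> openin mtopology U" for U
  proof -
    have "mball x e \<subseteq> U \<longleftrightarrow> (\<forall>y\<in>M. d x y < e \<longrightarrow> y \<in> U)" if "x \<in> M" for x e
      using that by (auto simp: mball_def)
    then show ?thesis
      unfolding openin_pseudometric_topology openin_mtopology by (metis subsetD)
  qed
  then show ?thesis by (simp add: topology_eq)
qed

definition screened_topology ::
    "('a::euclidean_space \<Rightarrow> ennreal) \<Rightarrow> real \<Rightarrow> real \<Rightarrow> ('a \<Rightarrow> real) topology" where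
  "screened_topology \<sigma> s p =
     pseudometric_topology (screened_space \<sigma> s p)
       (\<lambda>f g. screened_seminorm \<sigma> s p (\<lambda>x. f x - g x))"

section \<open>The quotient modulo constants\<close>

definition const_rel ::
    "('a::euclidean_space \<Rightarrow> ennreal) \<Rightarrow> real \<Rightarrow> real \<Rightarrow> (('a \<Rightarrow> real) \<times> ('a \<Rightarrow> real)) set" where
  "const_rel \<sigma> s p =
     {(f, g). f \<in> screened_space \<sigma> s p \<and> g \<in> screened_space \<sigma> s p \<and>
       (\<exists>c. AE x in lebesgue. f x - g x = c)}"

lemma equiv_const_rel: "equiv (screened_space \<sigma> s p) (const_rel \<sigma> s p)"
proof (rule equivI)
  show "const_rel \<sigma> s p \<subseteq> screened_space \<sigma> s p \<times> screened_space \<sigma> s p"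
    by (auto simp: const_rel_def)
  show "refl_on (screened_space \<sigma> s p) (const_rel \<sigma> s p)"
    by (auto simp: refl_on_def const_rel_def intro!: exI[of _ 0])
  show "sym (const_rel \<sigma> s p)"
  proof (rule symI)
    fix f g assume fg: "(f, g) \<in> const_rel \<sigma> s p"
    then obtain c where "AE x in lebesgue. f x - g x = c" by (auto simp: const_rel_def)
    then have "AE x in lebesgue. g x - f x = - c" by eventually_elim simp
    then show "(g, f) \<in> const_rel \<sigma> s p" using fg by (auto simp: const_rel_def)
  qed
  show "trans (const_rel \<sigma> s p)"
  proof (rule transI)
    fix f g k assume fg: "(f, g) \<in> const_rel \<sigma> s p" and gk: "(g, k) \<in> const_rel \<sigma> s p"
    then obtain c c' where "AE x in lebesgue. f x - g x = c" "AE x in lebesgue. g x - k x = c'"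
      by (auto simp: const_rel_def)
    then have "AE x in lebesgue. f x - k x = c + c'" by eventually_elim simp
    then show "(f, k) \<in> const_rel \<sigma> s p" using fg gk by (auto simp: const_rel_def)
  qed
qed

definition class_diff :: "('a \<Rightarrow> real) set \<Rightarrow> ('a \<Rightarrow> real) set \<Rightarrow> ('a \<Rightarrow> real) set" where
  "class_diff X Y = {(\<lambda>x. f x - g x) | f g. f \<in> X \<and> g \<in> Y}"

text \<open>The common value of the seminorm on the representatives.\<close>

definition quotient_norm ::
    "('a::euclidean_space \<Rightarrow> ennreal) \<Rightarrow> real \<Rightarrow> real \<Rightarrow> ('a \<Rightarrow> real) set \<Rightarrow> real" where
  "quotient_norm \<sigma> s p X = the_elem (screened_seminorm \<sigma> s p ` X)"

definition quotient_topology ::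
    "('a::euclidean_space \<Rightarrow> ennreal) \<Rightarrow> real \<Rightarrow> real \<Rightarrow> ('a \<Rightarrow> real) set topology" where
  "quotient_topology \<sigma> s p =
     pseudometric_topology (screened_space \<sigma> s p // const_rel \<sigma> s p)
       (\<lambda>X Y. quotient_norm \<sigma> s p (class_diff X Y))"

lemma AE_lebesgue_translate:
  fixes x :: "'a::euclidean_space"
  assumes "AE y in lebesgue. P y"
  shows "AE h in lebesgue. P (x + h)"
proof -
  obtain N where N: "N \<in> null_sets lebesgue" "{y. \<not> P y} \<subseteq> N"
    using assms by (auto simp: eventually_ae_filter)
  have "(+) (- x) ` N \<in> null_sets lebesgue"
    using N(1) negligible_translation[of N "- x"] by (simp only: negligible_iff_null_sets)
  moreover have "{h. \<not> P (x + h)} \<subseteq> (+) (- x) ` N"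
  proof
    fix h assume "h \<in> {h. \<not> P (x + h)}"
    then have "x + h \<in> N" using N(2) by auto
    then have "- x + (x + h) \<in> (+) (- x) ` N" by (rule imageI)
    then show "h \<in> (+) (- x) ` N" by simp
  qed
  ultimately show ?thesis by (auto simp: eventually_ae_filter)
qed

lemma screened_seminorm_cong_const:
  assumes "AE x in lebesgue. f x - g x = c"
  shows "screened_seminorm \<sigma> s p f = screened_seminorm \<sigma> s p g"
proof -
  have "screened_energy \<sigma> s p f = screened_energy \<sigma> s p g"
    unfolding screened_energy_def
  proof (rule nn_integral_cong_AE, use assms in eventually_elim)
    case (elim x)
    have "AE h in lebesgue. f (x + h) - g (x + h) = c"
      using assms by (rule AE_lebesgue_translate)
    then have "AE h in lebesgue. f (x + h) - f x = g (x + h) - g x"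
      by eventually_elim (use elim in simp)
    then show ?case
      by (intro nn_integral_cong_AE) (auto elim!: eventually_mono)
  qed
  then show ?thesis by (simp add: screened_seminorm_def)
qed

lemma quotient_norm_class:
  assumes "f \<in> screened_space \<sigma> s p"
  shows "quotient_norm \<sigma> s p (const_rel \<sigma> s p `` {f}) = screened_seminorm \<sigma> s p f"
proof -
  have "f \<in> const_rel \<sigma> s p `` {f}"
    using assms equiv_class_self[OF equiv_const_rel] by blast
  moreover have "screened_seminorm \<sigma> s p g = screened_seminorm \<sigma> s p f"
    if "g \<in> const_rel \<sigma> s p `` {f}" for g
    using that by (auto simp: const_rel_def intro: screened_seminorm_cong_const[symmetric])
  ultimately have "screened_seminorm \<sigma> s p ` (const_rel \<sigma> s p `` {f}) = {screened_seminorm \<sigma> s p f}"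
    by blast
  then show ?thesis by (simp add: quotient_norm_def)
qed

lemma quotient_norm_class_diff:
  assumes f: "f \<in> screened_space \<sigma> s p" and g: "g \<in> screened_space \<sigma> s p"
  shows "quotient_norm \<sigma> s p (class_diff (const_rel \<sigma> s p `` {f}) (const_rel \<sigma> s p `` {g})) =
    screened_seminorm \<sigma> s p (\<lambda>x. f x - g x)" (is "_ = ?r")
proof -
  let ?D = "class_diff (const_rel \<sigma> s p `` {f}) (const_rel \<sigma> s p `` {g})"
  have "f \<in> const_rel \<sigma> s p `` {f}" "g \<in> const_rel \<sigma> s p `` {g}"
    using f g equiv_class_self[OF equiv_const_rel] by blast+
  then have "(\<lambda>x. f x - g x) \<in> ?D" unfolding class_diff_def by blast
  moreover have "screened_seminorm \<sigma> s p k = ?r" if "k \<in> ?D" for k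
  proof -
    obtain f' g' where k: "k = (\<lambda>x. f' x - g' x)"
      and "(f, f') \<in> const_rel \<sigma> s p" "(g, g') \<in> const_rel \<sigma> s p"
      using \<open>k \<in> ?D\<close> by (auto simp: class_diff_def)
    then obtain c c' where "AE x in lebesgue. f x - f' x = c" "AE x in lebesgue. g x - g' x = c'"
      by (auto simp: const_rel_def)
    then have "AE x in lebesgue. (f x - g x) - k x = c - c'"
      by eventually_elim (simp add: k)
    then show ?thesis by (rule screened_seminorm_cong_const[symmetric])
  qed
  ultimately have "screened_seminorm \<sigma> s p ` ?D = {?r}" by blast
  then show ?thesis by (simp add: quotient_norm_def)
qed

end

(* Since \<sigma> lies between two positive constants a and b, the screened energy lies between the energies
   with constant radii a and b. Splitting an increment f(x + 2h) - f(x) at x + h shows that doubling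
   the radius preserves finiteness of the energy, so finite screened energy gives finite energy of
   radius b. The latter is the p-th power of an L^p norm of the increments on the product space,
   on which translations in x are continuous; by Jensen's inequality the energy of radius b of
   f - \<eta> * f is at most the supremum of that of f - f(. + y) over y in the support of the
   mollifier \<eta>, hence small. *)

theory Submission
  imports Defs
begin

section \<open>Continuity of translations\<close>

text \<open>Two obstacles shape the argument. The kernel is not integrable at the origin and
  \<open>f\<close> itself need not lie in L^p, so closeness of \<open>f\<close> to its translates
  has to be measured on the increments with their weight. Only the variable x is ever translated or
  averaged; the singular weight in h then rides along unchanged, and the estimates can be stated for
  an arbitrary nonnegative Borel weight. Secondly, a radius depending on x does not survive a
  translation in x, which forces the detour through constant radii: the lower bound of \<sigma>
  turns membership into finiteness, the upper bound turns smallness back into the screened seminorm.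
  Between the two only finiteness is transported, so the large constants of the iterated doubling
  never enter the final estimate.\<close>

lemma nn_integral_lborel_translate:
  fixes f :: "'a::euclidean_space \<Rightarrow> ennreal"
  assumes [measurable]: "f \<in> borel_measurable borel"
  shows "(\<integral>\<^sup>+x. f (x + c) \<partial>lborel) = (\<integral>\<^sup>+x. f x \<partial>lborel)"
proof -
  have "(\<integral>\<^sup>+x. f x \<partial>lborel) = (\<integral>\<^sup>+x. f x \<partial>distr lborel borel ((+) c))"
    by (simp add: lborel_distr_plus)
  also have "\<dots> = (\<integral>\<^sup>+x. f (x + c) \<partial>lborel)"
    by (subst nn_integral_distr) (auto simp: add.commute)
  finally show ?thesis ..
qed

lemma integrable_lborel_translate:
  fixes f :: "'a::euclidean_space \<Rightarrow> real"
  assumes "integrable lborel f"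
  shows "integrable lborel (\<lambda>x. f (x + c))"
proof -
  have "integrable (distr lborel borel ((+) c)) f"
    using assms by (simp add: lborel_distr_plus)
  then show ?thesis
    by (subst (asm) integrable_distr_eq) (use assms in \<open>auto simp: add.commute borel_measurable_integrable\<close>)
qed

lemma integral_lborel_translate:
  fixes f :: "'a::euclidean_space \<Rightarrow> real"
  assumes "integrable lborel f"
  shows "(LINT x|lborel. f (x + c)) = (LINT x|lborel. f x)"
proof -
  have "(LINT x|lborel. f x) = (LINT x|distr lborel borel ((+) c). f x)"
    by (simp add: lborel_distr_plus)
  also have "\<dots> = (LINT x|lborel. f (x + c))"
    using borel_measurable_integrable[OF assms]
    by (subst integral_distr) (auto simp: add.commute)
  finally show ?thesis ..
qed

text \<open>Translation preserves the measure of \<open>U\<close>, so the symmetric difference has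
  twice the measure of the set of x in \<open>U\<close> with x + c outside \<open>U\<close>. That
  half is dominated by \<open>indicator U\<close>, and openness makes it vanish pointwise.\<close>

lemma translation_error_tendsto_open:
  fixes U :: "'a::euclidean_space set" and y :: "nat \<Rightarrow> 'a"
  assumes U: "open U" "emeasure lborel U < \<infinity>" and y: "y \<longlonglongrightarrow> 0"
  shows "(\<lambda>n. LINT x|lborel. \<bar>indicator U (x + y n) - indicator U x :: real\<bar>) \<longlonglongrightarrow> 0"
proof -
  let ?i = "indicator U :: 'a \<Rightarrow> real"
  have [measurable]: "U \<in> sets borel" using U by simp
  have int: "integrable lborel ?i" using U by (simp add: integrable_indicator_iff)
  have intt: "integrable lborel (\<lambda>x. ?i (x + c))" for c using integrable_lborel_translate[OF int] .
  have intp: "integrable lborel (\<lambda>x. ?i x * (1 - ?i (x + c)))" for c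
    by (rule Bochner_Integration.integrable_bound[OF int]) (auto split: split_indicator)
  \<comment> \<open>For indicator values u at x and v at x + c, |v - u| = (v - u) + 2 u (1 - v), and
    v - u has integral zero.\<close>
  have eq: "(LINT x|lborel. \<bar>?i (x + c) - ?i x\<bar>) = 2 * (LINT x|lborel. ?i x * (1 - ?i (x + c)))" for c
  proof -
    have "(LINT x|lborel. \<bar>?i (x + c) - ?i x\<bar>) =
        (LINT x|lborel. (?i (x + c) - ?i x) + 2 * (?i x * (1 - ?i (x + c))))"
      by (intro Bochner_Integration.integral_cong) (auto split: split_indicator)
    also have "\<dots> = 2 * (LINT x|lborel. ?i x * (1 - ?i (x + c)))"
      using integral_lborel_translate[OF int] intp[of c] intt[of c] int by simp
    finally show ?thesis .
  qed
  have "(\<lambda>n. LINT x|lborel. ?i x * (1 - ?i (x + y n))) \<longlonglongrightarrow> (LINT x|(lborel :: 'a measure). 0 :: real)"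
  proof (rule integral_dominated_convergence[where w = ?i])
    show "AE x in lborel. (\<lambda>n. ?i x * (1 - ?i (x + y n))) \<longlonglongrightarrow> 0"
    proof (rule AE_I2)
      fix x
      show "(\<lambda>n. ?i x * (1 - ?i (x + y n))) \<longlonglongrightarrow> 0"
      proof (cases "x \<in> U")
        case True
        have "(\<lambda>n. x + y n) \<longlonglongrightarrow> x + 0" using y by (intro tendsto_intros)
        then have "\<forall>\<^sub>F n in sequentially. x + y n \<in> U"
          using U(1) True by (metis add.right_neutral topological_tendstoD)
        then have "\<forall>\<^sub>F n in sequentially. ?i x * (1 - ?i (x + y n)) = 0"
          by eventually_elim simp
        then show ?thesis by (rule tendsto_eventually)
      qed simp
    qed
  qed (use int in \<open>auto split: split_indicator\<close>)
  then show ?thesis unfolding eq using tendsto_mult_left[of _ 0 sequentially 2] by fastforce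
qed

text \<open>The error is subadditive and at most twice the L^1 norm, so the claim passes to L^1
  limits. Outer regularity then reduces Borel sets to open ones, and the same closedness handles the
  limit case of the induction.\<close>

lemma translation_error_tendsto:
  fixes g :: "'a::euclidean_space \<Rightarrow> real" and y :: "nat \<Rightarrow> 'a"
  assumes g: "integrable lborel g" and y: "y \<longlonglongrightarrow> 0"
  shows "(\<lambda>n. LINT x|lborel. \<bar>g (x + y n) - g x\<bar>) \<longlonglongrightarrow> 0"
proof -
  let ?E = "\<lambda>f c. LINT x|lborel. \<bar>f (x + c) - f x :: real\<bar>"
  have int[intro]: "integrable lborel (\<lambda>x. \<bar>f (x + c) - f x :: real\<bar>)" if "integrable lborel f" for f and c :: 'a
    using integrable_lborel_translate[OF that, of c] that by auto
  have E_ge0: "0 \<le> ?E f c" for f and c :: 'a by simp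
  have E_add: "?E (\<lambda>x. f x + h x) c \<le> ?E f c + ?E h c"
    if "integrable lborel f" "integrable lborel h" for f h and c :: 'a
  proof -
    have "?E (\<lambda>x. f x + h x) c \<le> (LINT x|lborel. \<bar>f (x + c) - f x\<bar> + \<bar>h (x + c) - h x\<bar>)"
      using that by (intro integral_mono int Bochner_Integration.integrable_add) auto
    then show ?thesis using that int by simp
  qed
  have E_bound: "?E f c \<le> 2 * (LINT x|lborel. \<bar>f x\<bar>)" if "integrable lborel f" for f and c :: 'a
  proof -
    have "?E f c \<le> (LINT x|lborel. \<bar>f (x + c)\<bar> + \<bar>f x\<bar>)"
      using that integrable_lborel_translate[OF that] by (intro integral_mono int) auto
    also have "\<dots> = 2 * (LINT x|lborel. \<bar>f x\<bar>)"
      using that integrable_lborel_translate[OF that]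
        integral_lborel_translate[of "\<lambda>x. \<bar>f x\<bar>" c] by simp
    finally show ?thesis .
  qed
  \<comment> \<open>Closedness under L^1 approximation: an approximant at distance below r/4 leaves
    a remainder with error below r/2, and its own error is eventually below r/2.\<close>
  have approx: "(\<lambda>n. ?E f (y n)) \<longlonglongrightarrow> 0"
    if f: "integrable lborel f"
      and h: "\<And>e. e > 0 \<Longrightarrow> \<exists>h. integrable lborel h \<and> (\<lambda>n. ?E h (y n)) \<longlonglongrightarrow> 0
        \<and> (LINT x|lborel. \<bar>f x - h x\<bar>) < e" for f
  proof (rule LIMSEQ_I)
    fix r :: real assume "0 < r"
    then obtain h where h: "integrable lborel h" "(\<lambda>n. ?E h (y n)) \<longlonglongrightarrow> 0"
      "(LINT x|lborel. \<bar>f x - h x\<bar>) < r / 4"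
      using h[of "r / 4"] by auto
    from h(2) have "\<forall>\<^sub>F n in sequentially. ?E h (y n) < r / 2"
      using \<open>0 < r\<close> by (intro order_tendstoD) auto
    then obtain N where N: "?E h (y n) < r / 2" if "n \<ge> N" for n
      by (auto simp: eventually_sequentially)
    have "norm (?E f (y n) - 0) < r" if "n \<ge> N" for n
    proof -
      have "?E f (y n) \<le> ?E h (y n) + ?E (\<lambda>x. f x - h x) (y n)"
        using E_add[of h "\<lambda>x. f x - h x" "y n"] f h by simp
      also have "\<dots> < r / 2 + 2 * (r / 4)"
        using N[OF that] E_bound[of "\<lambda>x. f x - h x" "y n"] f h by simp
      finally show ?thesis using E_ge0[of f "y n"] by simp
    qed
    then show "\<exists>no. \<forall>n\<ge>no. norm (?E f (y n) - 0) < r" by blast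
  qed
  show ?thesis using g
  proof (induction rule: integrable_induct)
    case (base A c)
    then have [measurable]: "A \<in> sets borel" by simp
    have A: "integrable lborel (indicator A :: 'a \<Rightarrow> real)" using base by (simp add: integrable_indicator_iff)
    have "(\<lambda>n. ?E (indicator A) (y n)) \<longlonglongrightarrow> 0"
    proof (rule approx[OF A])
      fix e :: real assume "e > 0"
      obtain U where U: "open U" "A \<subseteq> U" "emeasure lborel (U - A) < e"
        using outer_regular_lborel[OF \<open>A \<in> sets borel\<close> \<open>e > 0\<close>] .
      then have [measurable]: "U \<in> sets borel" by simp
      have "emeasure lborel U = emeasure lborel A + emeasure lborel (U - A)"
        using U by (subst plus_emeasure) (auto simp: Un_absorb1)
      then have fin: "emeasure lborel U < \<infinity>"
        using base U(3) order.strict_trans[OF U(3) ennreal_less_top] by (simp add: less_top[symmetric])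
      have "(LINT x|lborel. \<bar>indicator A x - indicator U x :: real\<bar>) = (LINT x|lborel. indicator (U - A) x)"
        using U(2) by (intro Bochner_Integration.integral_cong) (auto split: split_indicator)
      also have "\<dots> = measure lborel (U - A)" by simp
      also have "\<dots> < e" using U(3) \<open>e > 0\<close>
        by (metis emeasure_eq_ennreal_measure ennreal_less_iff measure_nonneg top.not_eq_extremum order.strict_trans ennreal_less_top)
      finally show "\<exists>h. integrable lborel h \<and> (\<lambda>n. ?E h (y n)) \<longlonglongrightarrow> 0
          \<and> (LINT x|lborel. \<bar>indicator A x - h x\<bar>) < e"
        using translation_error_tendsto_open[OF U(1) fin y] fin
        by (intro exI[of _ "indicator U"]) (auto simp: integrable_indicator_iff)
    qed
    then have "(\<lambda>n. \<bar>c\<bar> * ?E (indicator A) (y n)) \<longlonglongrightarrow> \<bar>c\<bar> * 0" by (intro tendsto_intros)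
    moreover have "?E (\<lambda>x. indicator A x *\<^sub>R c) z = \<bar>c\<bar> * ?E (indicator A) z" for z
      by (subst integral_mult_right_zero[symmetric])
        (auto intro!: Bochner_Integration.integral_cong simp: abs_mult[symmetric] algebra_simps)
    ultimately show ?case by simp
  next
    case (add f h)
    have *: "(\<lambda>n. ?E f (y n) + ?E h (y n)) \<longlonglongrightarrow> 0"
      using tendsto_add[OF add(3,4)] by simp
    show ?case
      by (rule tendsto_sandwich[OF _ _ tendsto_const *])
        (use E_add add in \<open>auto intro!: always_eventually\<close>)
  next
    case (lim f s)
    show ?case
    proof (rule approx[OF lim(4)])
      fix e :: real assume "e > 0"
      have "(\<lambda>i. LINT x|lborel. \<bar>f x - s i x\<bar>) \<longlonglongrightarrow> (LINT x|(lborel :: 'a measure). 0 :: real)"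
      \<comment> \<open>The induction rule supplies |s i x| \<le> 2 |f x|, whence the factor
        3.\<close>
      proof (rule integral_dominated_convergence[where w = "\<lambda>x. 3 * \<bar>f x\<bar>"])
        show "AE x in lborel. (\<lambda>i. \<bar>f x - s i x\<bar>) \<longlonglongrightarrow> 0"
        proof (rule AE_I2)
          fix x :: 'a
          have "(\<lambda>i. \<bar>f x - s i x\<bar>) \<longlonglongrightarrow> \<bar>f x - f x\<bar>"
            using lim(2)[of x] by (intro tendsto_intros) auto
          then show "(\<lambda>i. \<bar>f x - s i x\<bar>) \<longlonglongrightarrow> 0" by simp
        qed
        show "AE x in lborel. norm \<bar>f x - s i x\<bar> \<le> 3 * \<bar>f x\<bar>" for i
          by (rule AE_I2) (use lim(3)[of _ i] in \<open>smt (verit) real_norm_def space_lborel UNIV_I space_borel\<close>)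
      qed (use lim in auto)
      then have "\<forall>\<^sub>F i in sequentially. (LINT x|lborel. \<bar>f x - s i x\<bar>) < e"
        using \<open>e > 0\<close> by (intro order_tendstoD) auto
      then obtain i where "(LINT x|lborel. \<bar>f x - s i x\<bar>) < e"
        by (auto simp: eventually_sequentially)
      then show "\<exists>h. integrable lborel h \<and> (\<lambda>n. ?E h (y n)) \<longlonglongrightarrow> 0 \<and> (LINT x|lborel. \<bar>f x - h x\<bar>) < e"
        using lim by blast
    qed
  qed
qed

section \<open>Inequalities for real powers\<close>

lemma powr_diff_superadditive:
  fixes a b p :: real
  assumes "1 \<le> p" "0 \<le> b" "b \<le> a"
  shows "(a - b) powr p + b powr p \<le> a powr p"
proof (cases "a = 0")
  case False
  then have a: "a > 0" using assms by simp
  \<comment> \<open>Applied to (a - b) / a and b / a, whose sum is 1, this is the inequality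
    normalised by a^p.\<close>
  have *: "t powr p \<le> t" if "0 \<le> t" "t \<le> 1" for t :: real
    using powr_mono'[of 1 p t] that assms by simp
  have "((a - b) / a) powr p + (b / a) powr p \<le> (a - b) / a + b / a"
    using assms a by (intro add_mono *) auto
  also have "\<dots> = 1" using a by (simp add: field_simps)
  finally show ?thesis using assms a by (simp add: powr_divide field_simps)
qed (use assms in auto)

lemma powr_add_le:
  fixes a b p :: real
  assumes "0 \<le> p" "0 \<le> a" "0 \<le> b"
  shows "(a + b) powr p \<le> 2 powr p * (a powr p + b powr p)"
proof -
  have "(a + b) powr p \<le> (2 * max a b) powr p"
    using assms by (intro powr_mono2) auto
  also have "\<dots> = 2 powr p * max a b powr p" using assms by (simp add: powr_mult)
  also have "max a b powr p \<le> a powr p + b powr p" by (simp add: max_def)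
  finally show ?thesis by simp
qed

text \<open>For equal signs superadditivity gives constant 1. The factor \<open>2 powr p\<close>
  comes from opposite signs, where the signed powers differ by |a|^p + |b|^p.\<close>

lemma powr_abs_diff_le:
  fixes a b p :: real
  assumes "1 \<le> p"
  shows "\<bar>a - b\<bar> powr p \<le> 2 powr p * \<bar>sgn a * \<bar>a\<bar> powr p - sgn b * \<bar>b\<bar> powr p\<bar>"
proof -
  have same: "\<bar>u - v\<bar> powr p \<le> 2 powr p * \<bar>u powr p - v powr p\<bar>" if "0 \<le> u" "0 \<le> v" for u v :: real
  proof -
    have "\<bar>u - v\<bar> powr p \<le> 1 * \<bar>u powr p - v powr p\<bar>"
      using powr_diff_superadditive[OF assms, of v u] powr_diff_superadditive[OF assms, of u v] that
      by (cases "v \<le> u") auto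
    also have "\<dots> \<le> 2 powr p * \<bar>u powr p - v powr p\<bar>"
      using assms by (intro mult_right_mono) (auto simp: ge_one_powr_ge_zero)
    finally show ?thesis .
  qed
  consider "0 \<le> a" "0 \<le> b" | "a < 0" "b < 0" | "0 \<le> a" "b < 0" | "a < 0" "0 \<le> b" by linarith
  then show ?thesis
  proof cases
    case 1
    then show ?thesis using same[of a b] by (auto simp: sgn_if)
  next
    case 2
    then show ?thesis using same[of "-a" "-b"] by (auto simp: sgn_if abs_minus_commute)
  next
    case 3
    then show ?thesis using powr_add_le[of p a "-b"] assms by (auto simp: sgn_if)
  next
    case 4
    then have "\<bar>sgn a * \<bar>a\<bar> powr p - sgn b * \<bar>b\<bar> powr p\<bar> = b powr p + (- a) powr p"
      using powr_ge_zero[of b p] powr_ge_zero[of "- a" p] by (simp add: sgn_if) (smt (verit) powr_ge_zero)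
    then show ?thesis using powr_add_le[of p b "-a"] assms 4 by simp
  qed
qed

section \<open>The energy of differences under mollification\<close>

text \<open>Young's inequality with weights 1/p and 1 - 1/p, applied to (t/m)^p and 1, bounds t/m;
  multiplying by p m^p turns it into the tangent line of t^p at m.\<close>

lemma powr_ge_tangent:
  fixes p t m :: real
  assumes "1 \<le> p" "0 \<le> t" "0 < m"
  shows "m powr p + p * m powr (p - 1) * (t - m) \<le> t powr p"
proof (cases "t = 0")
  case True
  have "m powr p + p * m powr (p - 1) * (t - m) = (1 - p) * m powr p"
    using assms True by (simp add: powr_diff field_simps)
  also have "\<dots> \<le> 0" using assms by (simp add: mult_nonpos_nonneg)
  finally show ?thesis using True by simp
next
  case False
  then have t: "t > 0" using assms by simp
  have "(1 / p) * ((t / m) powr p) + (1 - 1 / p) * 1 \<ge> ((t / m) powr p) powr (1 / p) * 1 powr (1 - 1 / p)"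
    using assms t by (intro Youngs_inequality_0) auto
  then have "t / m \<le> (1 / p) * ((t / m) powr p) + (1 - 1 / p)"
    using assms t by (simp add: powr_powr)
  then have "p * (t / m) \<le> p * ((1 / p) * ((t / m) powr p) + (1 - 1 / p))"
    using assms by (intro mult_left_mono) auto
  also have "\<dots> = (t / m) powr p + (p - 1)"
    using assms by (simp add: field_simps)
  finally have "m powr p * (p * (t / m) - (p - 1)) \<le> m powr p * (t / m) powr p"
    by (intro mult_left_mono) auto
  also have "\<dots> = t powr p" using assms t by (simp add: powr_divide)
  finally show ?thesis using assms by (simp add: powr_diff field_simps)
qed

text \<open>Jensen's inequality for the probability density \<eta>: integrate the tangent line of
  t^p at the mean m of |X|, whose linear term averages to zero. The case m = 0 is split off because
  the tangent is taken at a positive point.\<close>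

lemma abs_integral_powr_le:
  fixes \<eta> X :: "'a::euclidean_space \<Rightarrow> real" and p :: real
  assumes p: "1 \<le> p" and \<eta>: "\<And>y. 0 \<le> \<eta> y" "integrable lborel \<eta>" "(LINT y|lborel. \<eta> y) = 1"
    and X: "integrable lborel (\<lambda>y. \<eta> y * X y)" and [measurable]: "X \<in> borel_measurable borel"
  shows "ennreal (\<bar>LINT y|lborel. \<eta> y * X y\<bar> powr p) \<le> (\<integral>\<^sup>+y. ennreal (\<eta> y * \<bar>X y\<bar> powr p) \<partial>lborel)"
proof (cases "(\<integral>\<^sup>+y. ennreal (\<eta> y * \<bar>X y\<bar> powr p) \<partial>lborel) = \<infinity>")
  case False
  have [measurable]: "\<eta> \<in> borel_measurable borel"
    using borel_measurable_integrable[OF \<eta>(2)] by simp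
  define m where "m = (LINT y|lborel. \<eta> y * \<bar>X y\<bar>)"
  have aX: "integrable lborel (\<lambda>y. \<eta> y * \<bar>X y\<bar>)"
    using integrable_abs[OF X] \<eta>(1) by (simp add: abs_mult)
  have Xp: "integrable lborel (\<lambda>y. \<eta> y * \<bar>X y\<bar> powr p)"
    using False \<eta>(1) by (intro integrableI_nonneg) (auto simp: less_top)
  have le: "\<bar>LINT y|lborel. \<eta> y * X y\<bar> \<le> m"
    unfolding m_def using integral_abs_bound[of lborel "\<lambda>y. \<eta> y * X y"] \<eta>(1) by (simp add: abs_mult)
  have "m powr p \<le> (LINT y|lborel. \<eta> y * \<bar>X y\<bar> powr p)"
  proof (cases "m > 0")
    case True
    have "m powr p = (LINT y|lborel. (m powr p - p * m powr (p - 1) * m) * \<eta> y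
        + p * m powr (p - 1) * (\<eta> y * \<bar>X y\<bar>))"
      using \<eta>(2,3) aX by (simp add: m_def[symmetric])
    also have "\<dots> \<le> (LINT y|lborel. \<eta> y * \<bar>X y\<bar> powr p)"
    proof (rule integral_mono)
      fix y
      have "\<eta> y * (m powr p + p * m powr (p - 1) * (\<bar>X y\<bar> - m)) \<le> \<eta> y * \<bar>X y\<bar> powr p"
        using powr_ge_tangent[OF p _ True] \<eta>(1) by (intro mult_left_mono) auto
      then show "(m powr p - p * m powr (p - 1) * m) * \<eta> y
          + p * m powr (p - 1) * (\<eta> y * \<bar>X y\<bar>) \<le> \<eta> y * \<bar>X y\<bar> powr p"
        by (simp add: algebra_simps)
    qed (use \<eta>(2) aX Xp in auto)
    finally show ?thesis .
  next
    case False
    then have "m = 0" using le by linarith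
    then show ?thesis using \<eta>(1) by (simp add: integral_nonneg_AE)
  qed
  then have "\<bar>LINT y|lborel. \<eta> y * X y\<bar> powr p \<le> (LINT y|lborel. \<eta> y * \<bar>X y\<bar> powr p)"
    using le p by (meson powr_mono2 abs_ge_zero order.trans zero_le_one)
  then show ?thesis
    using nn_integral_eq_integral[OF Xp] \<eta>(1) by (simp add: ennreal_leI)
qed simp

text \<open>The p-th power of a weighted L^p norm of increments. The weight depends on h alone, so
  translating or averaging \<open>f\<close> in x commutes with it. With \<open>lborel\<close>,
  Tonelli and changes of variables apply directly to Borel integrands.\<close>

definition difference_energy :: "('a::euclidean_space \<Rightarrow> real) \<Rightarrow> real \<Rightarrow> ('a \<Rightarrow> real) \<Rightarrow> ennreal" where
  "difference_energy w p f =
     (\<integral>\<^sup>+x. (\<integral>\<^sup>+h. ennreal (w h * \<bar>f (x + h) - f x\<bar> powr p) \<partial>lborel) \<partial>lborel)"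

text \<open>A crude constant in place of Minkowski's inequality: the lemma only serves to pass
  finiteness from a function and its approximation error to the approximant.\<close>

lemma difference_energy_triangle:
  fixes w f g :: "'a::euclidean_space \<Rightarrow> real"
  assumes p: "1 \<le> p" and w: "\<And>h. 0 \<le> w h"
    and [measurable]: "w \<in> borel_measurable borel" "f \<in> borel_measurable borel" "g \<in> borel_measurable borel"
  shows "difference_energy w p (\<lambda>x. f x - g x) \<le>
    ennreal (2 powr p) * (difference_energy w p f + difference_energy w p g)"
proof -
  have pt: "ennreal (w h * \<bar>(f (x + h) - g (x + h)) - (f x - g x)\<bar> powr p) \<le>
      ennreal (2 powr p) * (ennreal (w h * \<bar>f (x + h) - f x\<bar> powr p) + ennreal (w h * \<bar>g (x + h) - g x\<bar> powr p))"
    for x h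
  proof -
    have "\<bar>(f (x + h) - g (x + h)) - (f x - g x)\<bar> powr p \<le> (\<bar>f (x + h) - f x\<bar> + \<bar>g (x + h) - g x\<bar>) powr p"
      using p by (intro powr_mono2) auto
    also have "\<dots> \<le> 2 powr p * (\<bar>f (x + h) - f x\<bar> powr p + \<bar>g (x + h) - g x\<bar> powr p)"
      using p by (intro powr_add_le) auto
    finally have "w h * \<bar>(f (x + h) - g (x + h)) - (f x - g x)\<bar> powr p \<le>
        w h * (2 powr p * (\<bar>f (x + h) - f x\<bar> powr p + \<bar>g (x + h) - g x\<bar> powr p))"
      using w by (intro mult_left_mono)
    also have "\<dots> = 2 powr p * (w h * \<bar>f (x + h) - f x\<bar> powr p + w h * \<bar>g (x + h) - g x\<bar> powr p)"
      by (simp add: algebra_simps)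
    finally show ?thesis using w by (simp add: ennreal_mult[symmetric] ennreal_plus[symmetric] ennreal_leI del: ennreal_plus)
  qed
  have "difference_energy w p (\<lambda>x. f x - g x) \<le>
      (\<integral>\<^sup>+x. (\<integral>\<^sup>+h. ennreal (2 powr p) * (ennreal (w h * \<bar>f (x + h) - f x\<bar> powr p) + ennreal (w h * \<bar>g (x + h) - g x\<bar> powr p)) \<partial>lborel) \<partial>lborel)"
    unfolding difference_energy_def by (intro nn_integral_mono pt)
  also have "\<dots> = ennreal (2 powr p) * (difference_energy w p f + difference_energy w p g)"
    unfolding difference_energy_def by (simp add: nn_integral_cmult nn_integral_add)
  finally show ?thesis .
qed

text \<open>Reduced to continuity of translations in \<open>L\<^sup>1\<close> of the product space via the signed power
  \<open>t \<mapsto> sgn t |t|\<^sup>p\<close>, whose inverse is Hoelder continuous of order \<open>1/p\<close>.\<close>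

lemma difference_energy_translate_tendsto:
  fixes w f :: "'a::euclidean_space \<Rightarrow> real" and y :: "nat \<Rightarrow> 'a"
  assumes p: "1 \<le> p" and w: "\<And>h. 0 \<le> w h"
    and [measurable]: "w \<in> borel_measurable borel" "f \<in> borel_measurable borel"
    and fin: "difference_energy w p f < \<infinity>" and y: "y \<longlonglongrightarrow> 0"
  shows "(\<lambda>n. difference_energy w p (\<lambda>x. f x - f (x + y n))) \<longlonglongrightarrow> 0"
proof -
  define D where "D z = f (fst z + snd z) - f (fst z)" for z :: "'a \<times> 'a"
  \<comment> \<open>|G| is the energy integrand, so finite energy means that \<open>G\<close> is
    integrable on the product. Keeping the sign of the increment lets differences of
    \<open>G\<close> control differences of \<open>D\<close>.\<close>
  define G where "G z = w (snd z) * (sgn (D z) * \<bar>D z\<bar> powr p)" for z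
  have [measurable]: "D \<in> borel_measurable borel" unfolding D_def borel_prod[symmetric] by measurable
  have [measurable]: "G \<in> borel_measurable borel" unfolding G_def borel_prod[symmetric]
    using \<open>D \<in> _\<close> unfolding borel_prod[symmetric] by measurable
  have absG: "\<bar>G z\<bar> = w (snd z) * \<bar>D z\<bar> powr p" for z
    using w[of "snd z"] by (auto simp: G_def abs_mult sgn_if)
  have en: "(\<integral>\<^sup>+z. F z \<partial>lborel) = (\<integral>\<^sup>+x. (\<integral>\<^sup>+h. F (x, h) \<partial>lborel) \<partial>lborel)"
    if "F \<in> borel_measurable borel" for F :: "'a \<times> 'a \<Rightarrow> ennreal"
  proof -
    have "F \<in> borel_measurable (lborel \<Otimes>\<^sub>M lborel)" using that by (simp add: lborel_prod)
    then show ?thesis by (subst lborel.nn_integral_fst) (simp_all add: lborel_prod)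
  qed
  have "(\<integral>\<^sup>+z. ennreal \<bar>G z\<bar> \<partial>lborel) = difference_energy w p f"
    unfolding difference_energy_def by (subst en) (measurable, simp add: absG D_def)
  then have G: "integrable lborel G"
    using fin by (intro integrableI_bounded) auto
  \<comment> \<open>Translation by (c, 0) moves x and fixes h, hence the weight.\<close>
  have y': "(\<lambda>n. (y n, 0 :: 'a)) \<longlonglongrightarrow> 0"
    using tendsto_Pair[OF y tendsto_const[of "0 :: 'a"]] by (simp add: zero_prod_def)
  have bound: "difference_energy w p (\<lambda>x. f x - f (x + c)) \<le>
      ennreal (2 powr p * (LINT z|lborel. \<bar>G (z + (c, 0)) - G z\<bar>))" for c
  proof -
    have int: "integrable lborel (\<lambda>z. 2 powr p * \<bar>G (z + (c, 0)) - G z\<bar>)"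
      using integrable_lborel_translate[OF G, of "(c, 0)"] G by auto
    have "difference_energy w p (\<lambda>x. f x - f (x + c)) \<le>
        (\<integral>\<^sup>+x. (\<integral>\<^sup>+h. ennreal (2 powr p * \<bar>G ((x, h) + (c, 0)) - G (x, h)\<bar>) \<partial>lborel) \<partial>lborel)"
      unfolding difference_energy_def
    proof (intro nn_integral_mono ennreal_leI)
      fix x h
      have "\<bar>(f (x + h) - f (x + h + c)) - (f x - f (x + c))\<bar> = \<bar>D (x + c, h) - D (x, h)\<bar>"
        by (simp add: D_def algebra_simps)
      also have "w h * \<dots> powr p \<le> w h * (2 powr p * \<bar>sgn (D (x + c, h)) * \<bar>D (x + c, h)\<bar> powr p
          - sgn (D (x, h)) * \<bar>D (x, h)\<bar> powr p\<bar>)"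
        using w p by (intro mult_left_mono powr_abs_diff_le) auto
      also have "\<dots> = 2 powr p * \<bar>G (x + c, h) - G (x, h)\<bar>"
        using w[of h] by (simp add: G_def right_diff_distrib[symmetric] abs_mult)
      finally show "w h * \<bar>(f (x + h) - f (x + h + c)) - (f x - f (x + c))\<bar> powr p
          \<le> 2 powr p * \<bar>G ((x, h) + (c, 0)) - G (x, h)\<bar>" by simp
    qed
    also have "\<dots> = (\<integral>\<^sup>+z. ennreal (2 powr p * \<bar>G (z + (c, 0)) - G z\<bar>) \<partial>lborel)"
      by (subst en) auto
    also have "\<dots> = ennreal (LINT z|lborel. 2 powr p * \<bar>G (z + (c, 0)) - G z\<bar>)"
      by (rule nn_integral_eq_integral[OF int]) auto
    finally show ?thesis by simp
  qed
  have "(\<lambda>n. ennreal (2 powr p * (LINT z|lborel. \<bar>G (z + (y n, 0)) - G z\<bar>))) \<longlonglongrightarrow> ennreal (2 powr p * 0)"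
    by (intro tendsto_ennrealI tendsto_intros translation_error_tendsto[OF G y'])
  then have lim: "(\<lambda>n. ennreal (2 powr p * (LINT z|lborel. \<bar>G (z + (y n, 0)) - G z\<bar>))) \<longlonglongrightarrow> 0" by simp
  show ?thesis
    by (rule tendsto_sandwich[OF _ _ tendsto_const lim]) (auto intro!: always_eventually bound)
qed

text \<open>Failure for every d would produce, with d = 1/(n + 1), a null sequence of translations
  contradicting the sequential statement.\<close>

lemma difference_energy_translate_small:
  fixes w f :: "'a::euclidean_space \<Rightarrow> real"
  assumes p: "1 \<le> p" and w: "\<And>h. 0 \<le> w h"
    and [measurable]: "w \<in> borel_measurable borel" "f \<in> borel_measurable borel"
    and fin: "difference_energy w p f < \<infinity>" and e: "0 < e"
  shows "\<exists>d>0. \<forall>y. norm y < d \<longrightarrow> difference_energy w p (\<lambda>x. f x - f (x + y)) < e"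
proof (rule ccontr)
  assume "\<not> ?thesis"
  then have *: "\<exists>y. norm y < d \<and> e \<le> difference_energy w p (\<lambda>x. f x - f (x + y))" if "d > 0" for d
    using that by (meson not_less)
  have "\<exists>y. norm y < inverse (real (Suc n)) \<and> e \<le> difference_energy w p (\<lambda>x. f x - f (x + y))" for n
    by (rule *) simp
  then obtain y where y: "norm (y n) < inverse (real (Suc n))"
    and ge: "e \<le> difference_energy w p (\<lambda>x. f x - f (x + y n))" for n
    by metis
  have "y \<longlonglongrightarrow> 0"
    by (rule Lim_null_comparison[OF always_eventually LIMSEQ_inverse_real_of_nat]) (use y in \<open>auto intro: less_imp_le\<close>)
  from difference_energy_translate_tendsto[OF p w _ _ fin this]
  have "(\<lambda>n. difference_energy w p (\<lambda>x. f x - f (x + y n))) \<longlonglongrightarrow> 0" by simp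
  then have "\<forall>\<^sub>F n in sequentially. difference_energy w p (\<lambda>x. f x - f (x + y n)) < e"
    using e by (intro order_tendstoD) auto
  then show False using ge by (auto simp: eventually_sequentially not_less[symmetric])
qed

text \<open>Since \<eta> has mass 1, \<open>f\<close> minus its average is the \<eta>-average of f -
  f(. + y). Jensen is applied to the increments of these differences, and Tonelli moves the
  y-integral outermost, where the bound \<open>e\<close> is averaged against mass 1.\<close>

lemma difference_energy_mollify:
  fixes w f \<eta> :: "'a::euclidean_space \<Rightarrow> real"
  assumes p: "1 \<le> p" and w: "\<And>h. 0 \<le> w h"
    and [measurable]: "w \<in> borel_measurable borel" "f \<in> borel_measurable borel"
    and \<eta>: "\<And>y. 0 \<le> \<eta> y" "integrable lborel \<eta>" "(LINT y|lborel. \<eta> y) = 1"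
    and int: "\<And>x. integrable lborel (\<lambda>y. \<eta> y * f (x + y))"
    and supp: "\<And>y. \<eta> y \<noteq> 0 \<Longrightarrow> difference_energy w p (\<lambda>x. f x - f (x + y)) \<le> e"
  shows "difference_energy w p (\<lambda>x. f x - (LINT y|lborel. \<eta> y * f (x + y))) \<le> e"
proof -
  have [measurable]: "\<eta> \<in> borel_measurable borel"
    using borel_measurable_integrable[OF \<eta>(2)] by simp
  let ?D = "\<lambda>y x h. (f (x + h) - f (x + h + y)) - (f x - f (x + y))"
  have pt: "ennreal (w h * \<bar>(f (x + h) - (LINT y|lborel. \<eta> y * f (x + h + y))) - (f x - (LINT y|lborel. \<eta> y * f (x + y)))\<bar> powr p)
      \<le> (\<integral>\<^sup>+y. ennreal (\<eta> y) * ennreal (w h * \<bar>?D y x h\<bar> powr p) \<partial>lborel)" for x h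
  proof -
    have intD: "integrable lborel (\<lambda>y. \<eta> y * ?D y x h)"
    proof -
      have "integrable lborel (\<lambda>y. (f (x + h) - f x) * \<eta> y - (\<eta> y * f (x + h + y) - \<eta> y * f (x + y)))"
        using \<eta>(2) int by (intro Bochner_Integration.integrable_diff integrable_mult_right) auto
      then show ?thesis by (simp add: algebra_simps)
    qed
    have "(LINT y|lborel. \<eta> y * ?D y x h) =
        (LINT y|lborel. (f (x + h) - f x) * \<eta> y - (\<eta> y * f (x + h + y) - \<eta> y * f (x + y)))"
      by (simp add: algebra_simps)
    also have "\<dots> = (f (x + h) - (LINT y|lborel. \<eta> y * f (x + h + y))) - (f x - (LINT y|lborel. \<eta> y * f (x + y)))"
      using \<eta>(2,3) int by simp
    finally have eq: "(f (x + h) - (LINT y|lborel. \<eta> y * f (x + h + y))) - (f x - (LINT y|lborel. \<eta> y * f (x + y)))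
        = (LINT y|lborel. \<eta> y * ?D y x h)" ..
    have "ennreal (\<bar>LINT y|lborel. \<eta> y * ?D y x h\<bar> powr p) \<le> (\<integral>\<^sup>+y. ennreal (\<eta> y * \<bar>?D y x h\<bar> powr p) \<partial>lborel)"
      by (rule abs_integral_powr_le[OF p \<eta> intD]) auto
    then have "ennreal (w h) * ennreal (\<bar>LINT y|lborel. \<eta> y * ?D y x h\<bar> powr p)
        \<le> ennreal (w h) * (\<integral>\<^sup>+y. ennreal (\<eta> y * \<bar>?D y x h\<bar> powr p) \<partial>lborel)"
      by (rule mult_left_mono) auto
    also have "\<dots> = (\<integral>\<^sup>+y. ennreal (\<eta> y) * ennreal (w h * \<bar>?D y x h\<bar> powr p) \<partial>lborel)"
      using w \<eta>(1) by (subst nn_integral_cmult[symmetric]) (auto intro!: nn_integral_cong simp: ennreal_mult[symmetric] algebra_simps)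
    finally show ?thesis unfolding eq using w by (simp add: ennreal_mult)
  qed
  have "difference_energy w p (\<lambda>x. f x - (LINT y|lborel. \<eta> y * f (x + y))) \<le>
      (\<integral>\<^sup>+x. (\<integral>\<^sup>+h. (\<integral>\<^sup>+y. ennreal (\<eta> y) * ennreal (w h * \<bar>?D y x h\<bar> powr p) \<partial>lborel) \<partial>lborel) \<partial>lborel)"
    unfolding difference_energy_def by (intro nn_integral_mono pt)
  also have "\<dots> = (\<integral>\<^sup>+x. (\<integral>\<^sup>+y. (\<integral>\<^sup>+h. ennreal (\<eta> y) * ennreal (w h * \<bar>?D y x h\<bar> powr p) \<partial>lborel) \<partial>lborel) \<partial>lborel)"
    by (intro nn_integral_cong lborel_pair.Fubini') measurable
  also have "\<dots> = (\<integral>\<^sup>+y. (\<integral>\<^sup>+x. (\<integral>\<^sup>+h. ennreal (\<eta> y) * ennreal (w h * \<bar>?D y x h\<bar> powr p) \<partial>lborel) \<partial>lborel) \<partial>lborel)"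
    by (intro lborel_pair.Fubini') measurable
  also have "\<dots> = (\<integral>\<^sup>+y. ennreal (\<eta> y) * difference_energy w p (\<lambda>x. f x - f (x + y)) \<partial>lborel)"
    unfolding difference_energy_def by (simp add: nn_integral_cmult)
  also have "\<dots> \<le> (\<integral>\<^sup>+y. ennreal (\<eta> y) * e \<partial>lborel)"
    \<comment> \<open>Where \<open>\<eta> y\<close> = 0 the energy is not controlled and may be
      infinite, but the product is 0 in \<open>ennreal\<close>.\<close>
    using supp by (intro nn_integral_mono) (metis ennreal_0 mult_left_mono mult_zero_left order_refl zero_le)
  also have "\<dots> = ennreal (LINT y|lborel. \<eta> y) * e"
    using nn_integral_eq_integral[OF \<eta>(2)] \<eta>(1) by (simp add: nn_integral_multc)
  finally show ?thesis using \<eta>(3) by simp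
qed

section \<open>Smoothness of mollifications\<close>

lemma cont_diff_SucI:
  fixes f :: "'a::euclidean_space \<Rightarrow> real"
  assumes "\<And>x. (f has_derivative f' x) (at x)" "\<And>b. b \<in> Basis \<Longrightarrow> cont_diff k (\<lambda>x. f' x b)"
  shows "cont_diff (Suc k) f"
proof -
  have "frechet_derivative f (at x) = f' x" for x
    using frechet_derivative_at[OF assms(1)] by simp
  then show ?thesis using assms by (auto simp: differentiable_def)
qed

lemma cont_diff_Suc_has_derivative:
  "cont_diff (Suc k) f \<Longrightarrow> (f has_derivative frechet_derivative f (at x)) (at x)"
  by (simp add: frechet_derivative_works)

lemma cont_diff_SucD: "cont_diff (Suc k) f \<Longrightarrow> cont_diff k f"
proof (induction k arbitrary: f)
  case 0
  then show ?case
    by (auto intro!: continuous_at_imp_continuous_on differentiable_imp_continuous_within)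
next
  case (Suc k)
  then show ?case by (metis cont_diff.simps(2))
qed

lemma cont_diff_const: "cont_diff k (\<lambda>_. c)"
  by (induction k arbitrary: c) (auto simp del: cont_diff.simps(2) intro!: cont_diff_SucI derivative_eq_intros)

lemma cont_diff_inner: "cont_diff k (\<lambda>x. x \<bullet> c)"
  by (cases k) (auto simp del: cont_diff.simps(2) intro!: cont_diff_SucI derivative_eq_intros cont_diff_const continuous_intros)

lemma cont_diff_add: "cont_diff k f \<Longrightarrow> cont_diff k g \<Longrightarrow> cont_diff k (\<lambda>x. f x + g x)"
proof (induction k arbitrary: f g)
  case (Suc k)
  show ?case
  proof (rule cont_diff_SucI)
    show "((\<lambda>x. f x + g x) has_derivative (\<lambda>v. frechet_derivative f (at x) v + frechet_derivative g (at x) v)) (at x)" for x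
      by (intro has_derivative_add cont_diff_Suc_has_derivative[of k] Suc.prems)
  qed (use Suc in auto)
qed (auto intro: continuous_intros)

lemma cont_diff_mult: "cont_diff k f \<Longrightarrow> cont_diff k g \<Longrightarrow> cont_diff k (\<lambda>x. f x * g x)"
proof (induction k arbitrary: f g)
  case (Suc k)
  show ?case
  proof (rule cont_diff_SucI)
    show "((\<lambda>x. f x * g x) has_derivative (\<lambda>v. f x * frechet_derivative g (at x) v + frechet_derivative f (at x) v * g x)) (at x)" for x
      by (intro has_derivative_mult cont_diff_Suc_has_derivative[of k] Suc.prems)
  \<comment> \<open>The product rule pairs first derivatives, of class k, with undifferentiated
    factors, whose order is lowered from \<open>Suc k\<close> to k.\<close>
  qed (use Suc Suc.prems[THEN cont_diff_SucD] in \<open>auto intro!: cont_diff_add\<close>)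
qed (auto intro: continuous_intros)

section \<open>A flat function and the mollifier\<close>

definition bump_aux :: "nat \<Rightarrow> real \<Rightarrow> real" where
  "bump_aux m t = (if 0 < t then inverse t ^ m / exp (inverse t) else 0)"

lemma bump_aux_nonneg: "0 \<le> bump_aux m t"
  by (simp add: bump_aux_def)

lemma bump_aux_tendsto_0: "(bump_aux m \<longlongrightarrow> 0) (at 0)"
proof -
  have "((\<lambda>t. inverse t ^ m / exp (inverse t)) \<longlongrightarrow> (0 :: real)) (at_right 0)"
    by (rule filterlim_compose[OF tendsto_power_div_exp_0 filterlim_inverse_at_top_right])
  then have "(bump_aux m \<longlongrightarrow> 0) (at_right 0)"
    by (rule Lim_transform_eventually) (auto simp: bump_aux_def eventually_at_filter)
  moreover have "(bump_aux m \<longlongrightarrow> 0) (at_left 0)"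
    by (rule tendsto_eventually) (auto simp: bump_aux_def eventually_at_filter)
  ultimately show ?thesis by (simp add: filterlim_split_at)
qed

text \<open>The family t^(-m) e^(-1/t) is indexed by m so that derivatives stay in its span. At 0
  the difference quotient of index m is the function of index m + 1, which tends to 0.\<close>

lemma bump_aux_has_derivative:
  "(bump_aux m has_real_derivative (bump_aux (m + 2) t - real m * bump_aux (m + 1) t)) (at t)"
proof -
  consider "t < 0" | "t = 0" | "0 < t" by linarith
  then show ?thesis
  proof cases
    case 1
    then have "bump_aux (m + 2) t - real m * bump_aux (m + 1) t = 0" by (simp add: bump_aux_def)
    moreover have "(bump_aux m has_real_derivative 0) (at t)"
      by (rule DERIV_cong_ev[THEN iffD2, OF refl _ refl, of _ "\<lambda>_. 0"])
        (use 1 eventually_nhds_in_open[of "{..<0}" t] in \<open>auto simp: bump_aux_def elim!: eventually_mono\<close>)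
    ultimately show ?thesis by simp
  next
    case 2
    have "bump_aux m h / h = bump_aux (m + 1) h" for h
      by (simp add: bump_aux_def field_simps)
    then have "(\<lambda>h. (bump_aux m (0 + h) - bump_aux m 0) / h) \<midarrow>0\<rightarrow> 0"
      using bump_aux_tendsto_0[of "m + 1"] by (simp add: bump_aux_def[of m 0])
    then show ?thesis using 2 by (simp add: DERIV_def bump_aux_def[of _ 0])
  next
    case 3
    have "((\<lambda>t. inverse t ^ m * exp (- inverse t)) has_real_derivative
        (inverse t ^ (m + 2) * exp (- inverse t) - real m * (inverse t ^ (m + 1) * exp (- inverse t)))) (at t)"
    proof (cases m)
      case (Suc j)
      show ?thesis unfolding Suc
        using 3 by (auto intro!: derivative_eq_intros simp del: power_Suc)
          (simp add: field_simps)
    qed (use 3 in \<open>auto intro!: derivative_eq_intros simp: field_simps power2_eq_square\<close>)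
    then have "((\<lambda>t. inverse t ^ m * exp (- inverse t)) has_real_derivative
        (bump_aux (m + 2) t - real m * bump_aux (m + 1) t)) (at t)"
      using 3 by (simp add: bump_aux_def exp_minus divide_inverse)
    then show ?thesis
      by (rule DERIV_cong_ev[THEN iffD2, OF refl _ refl, rotated])
        (use 3 eventually_nhds_in_open[of "{0<..}" t] in \<open>auto simp: bump_aux_def exp_minus divide_inverse elim!: eventually_mono\<close>)
  qed
qed

text \<open>The induction on k runs over all m at once, because differentiating index m produces
  indices m + 1 and m + 2.\<close>

lemma cont_diff_bump_aux_compose:
  assumes u: "\<And>k. cont_diff k u"
  shows "cont_diff k (\<lambda>x. bump_aux m (u x))"
proof (induction k arbitrary: m)
  have du: "(u has_derivative frechet_derivative u (at x)) (at x)" for x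
    using u by (rule cont_diff_Suc_has_derivative)
  have der: "((\<lambda>x. bump_aux m (u x)) has_derivative
      (\<lambda>v. (bump_aux (m + 2) (u x) - real m * bump_aux (m + 1) (u x)) * frechet_derivative u (at x) v)) (at x)" for x m
    using has_derivative_compose[OF du, of "bump_aux m"] bump_aux_has_derivative[of m "u x"]
    by (simp add: has_field_derivative_def)
  {
    case 0
    show ?case using der
      by (auto intro!: continuous_at_imp_continuous_on has_derivative_continuous)
  next
    case (Suc k)
    show ?case
    proof (rule cont_diff_SucI[OF der])
      fix b :: 'a assume "b \<in> Basis"
      have "cont_diff k (\<lambda>x. bump_aux (m + 2) (u x) + (- real m) * bump_aux (m + 1) (u x))"
        by (intro cont_diff_add cont_diff_mult cont_diff_const Suc.IH)
      moreover have "cont_diff k (\<lambda>x. frechet_derivative u (at x) b)"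
        using u[of "Suc k"] \<open>b \<in> Basis\<close> by simp
      ultimately show "cont_diff k (\<lambda>x. (bump_aux (m + 2) (u x) - real m * bump_aux (m + 1) (u x)) * frechet_derivative u (at x) b)"
        using cont_diff_mult by fastforce
    qed
  }
qed

lemma cont_diff_inner_self: "cont_diff k (\<lambda>x. x \<bullet> x)"
proof (cases k)
  case (Suc j)
  show ?thesis unfolding Suc
  proof (rule cont_diff_SucI)
    show "((\<lambda>x::'a. x \<bullet> x) has_derivative (\<lambda>v. 2 * (x \<bullet> v))) (at x)" for x
      by (auto intro!: derivative_eq_intros simp: inner_commute)
  qed (auto intro!: cont_diff_mult cont_diff_const cont_diff_inner)
qed (auto intro!: continuous_intros)

text \<open>The normalised function e^(-1 / (r^2 - |y|^2)), extended by 0. Its evenness later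
  identifies the convolution with an average of translates.\<close>

lemma ex_mollifier:
  assumes "0 < r"
  obtains \<eta> :: "'a::euclidean_space \<Rightarrow> real" where
    "\<And>k. cont_diff k \<eta>" "\<And>y. 0 \<le> \<eta> y" "\<And>y. r \<le> norm y \<Longrightarrow> \<eta> y = 0" "\<And>y. \<eta> (- y) = \<eta> y"
    "integrable lborel \<eta>" "(LINT y|lborel. \<eta> y) = 1"
proof -
  \<comment> \<open>Writing \<open>+ (- 1) *\<close> for the subtraction lets closure under sums and
    products apply. The argument is positive exactly on the open ball of radius r.\<close>
  define \<phi> :: "'a \<Rightarrow> real" where "\<phi> y = bump_aux 0 (r\<^sup>2 + (- 1) * (y \<bullet> y))" for y
  have smooth: "cont_diff k \<phi>" for k
    unfolding \<phi>_def
    by (intro cont_diff_bump_aux_compose cont_diff_add cont_diff_mult cont_diff_const cont_diff_inner_self)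
  have iff: "0 < r\<^sup>2 + (- 1) * (y \<bullet> y) \<longleftrightarrow> norm y < r" for y :: 'a
    using assms power_less_imp_less_base[of "norm y" 2 r] power_strict_mono[of "norm y" r 2]
    by (auto simp: power2_norm_eq_inner[symmetric])
  have nonneg: "0 \<le> \<phi> y" for y by (simp add: \<phi>_def bump_aux_nonneg)
  have zero: "\<phi> y = 0" if "r \<le> norm y" for y
    using iff[of y] that by (simp add: \<phi>_def bump_aux_def)
  have pos: "0 < \<phi> y" if "norm y < r" for y
    using iff[of y] that by (simp add: \<phi>_def bump_aux_def)
  have cont: "continuous_on UNIV \<phi>" using smooth[of 0] by simp
  then have [measurable]: "\<phi> \<in> borel_measurable borel" by (rule borel_measurable_continuous_onI)
  have "(\<lambda>y. indicator (cball 0 r) y *\<^sub>R \<phi> y) = \<phi>"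
    using zero by (intro ext) (auto split: split_indicator)
  then have int: "integrable lborel \<phi>"
    using borel_integrable_compact[of "cball 0 r" \<phi>] continuous_on_subset[OF cont] by simp
  \<comment> \<open>Were the integral zero, positivity of \<phi> on the ball would make a nonempty
    open set negligible.\<close>
  have "(LINT y|lborel. \<phi> y) \<noteq> 0"
  proof
    assume "(LINT y|lborel. \<phi> y) = 0"
    then have "AE y in lborel. \<phi> y = 0"
      using integral_nonneg_eq_0_iff_AE[OF int] nonneg by simp
    then have "AE y in lborel. y \<notin> ball (0::'a) r"
      by eventually_elim (use pos in force)
    then have "ball (0::'a) r \<in> null_sets lborel" by (simp add: AE_iff_null_sets)
    then have "ball (0::'a) r \<in> null_sets lebesgue" by (rule null_sets_completionI)
    then have "negligible (ball (0::'a) r)" by (simp only: negligible_iff_null_sets)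
    then show False using open_not_negligible[of "ball (0::'a) r"] assms by simp
  qed
  moreover have "0 \<le> (LINT y|lborel. \<phi> y)" using nonneg by simp
  ultimately have I: "0 < (LINT y|lborel. \<phi> y)" by simp
  show ?thesis
  proof (rule that[of "\<lambda>y. inverse (LINT y|lborel. \<phi> y) * \<phi> y"])
    show "inverse (LINT y|lborel. \<phi> y) * \<phi> (- y) = inverse (LINT y|lborel. \<phi> y) * \<phi> y" for y
      by (simp add: \<phi>_def)
  qed (use I smooth nonneg zero int in \<open>auto intro!: cont_diff_mult cont_diff_const\<close>)
qed

section \<open>Convolution with a smooth kernel of compact support\<close>

lemma uniformly_continuous_compact_support:
  fixes \<phi> :: "'a::euclidean_space \<Rightarrow> 'b::real_normed_vector"
  assumes cont: "continuous_on UNIV \<phi>" and supp: "\<And>z. r < norm z \<Longrightarrow> \<phi> z = 0" and e: "0 < e"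
  shows "\<exists>d>0. \<forall>z z'. norm (z - z') < d \<longrightarrow> norm (\<phi> z - \<phi> z') < e"
proof -
  \<comment> \<open>The margin 1 matches the restriction to distances below 1: either both points
    lie in this compact ball or both lie where \<phi> vanishes.\<close>
  have "uniformly_continuous_on (cball 0 (r + 1)) \<phi>"
    by (rule compact_uniformly_continuous) (auto intro: continuous_on_subset[OF cont])
  then obtain d where d: "d > 0"
    "\<And>z z'. z \<in> cball 0 (r + 1) \<Longrightarrow> z' \<in> cball 0 (r + 1) \<Longrightarrow> dist z z' < d \<Longrightarrow> dist (\<phi> z) (\<phi> z') < e"
    using e unfolding uniformly_continuous_on_def by metis
  have "norm (\<phi> z - \<phi> z') < e" if *: "norm (z - z') < min d 1" for z z'
  proof (cases "norm z \<le> r + 1 \<and> norm z' \<le> r + 1")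
    case True
    then show ?thesis using d(2)[of z z'] * by (auto simp: dist_norm)
  next
    case False
    then have "r < norm z" "r < norm z'"
      using * norm_triangle_ineq3[of z z'] by linarith+
    then show ?thesis using supp e by simp
  qed
  then show ?thesis using d(1) by (intro exI[of _ "min d 1"]) auto
qed

text \<open>The kernel is bounded and the integrand vanishes off the ball of radius |x| + r, so a
  multiple of |f| on that ball dominates.\<close>

lemma integrable_convolution:
  fixes \<phi> f :: "'a::euclidean_space \<Rightarrow> real"
  assumes cont: "continuous_on UNIV \<phi>" and supp: "\<And>z. r < norm z \<Longrightarrow> \<phi> z = 0"
    and [measurable]: "f \<in> borel_measurable borel" and f: "\<And>R. set_integrable lborel (cball 0 R) f"
  shows "integrable lborel (\<lambda>z. \<phi> (x - z) * f z)"
proof -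
  have [measurable]: "\<phi> \<in> borel_measurable borel" using cont by (rule borel_measurable_continuous_onI)
  have "bounded (\<phi> ` cball 0 r)"
    by (intro compact_imp_bounded compact_continuous_image continuous_on_subset[OF cont]) auto
  then obtain B where B: "B > 0" "\<And>z. z \<in> cball 0 r \<Longrightarrow> \<bar>\<phi> z\<bar> \<le> B"
    by (auto simp: bounded_pos)
  have B': "\<bar>\<phi> z\<bar> \<le> B" for z using B supp[of z] by (cases "norm z \<le> r") auto
  have "integrable lborel (\<lambda>z. B * (indicator (cball 0 (norm x + r)) z *\<^sub>R f z))"
    using f[of "norm x + r"] unfolding set_integrable_def by (intro integrable_mult_right) auto
  then show ?thesis
  proof (rule Bochner_Integration.integrable_bound)
    show "AE z in lborel. norm (\<phi> (x - z) * f z) \<le> norm (B * (indicator (cball 0 (norm x + r)) z *\<^sub>R f z))"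
    proof (rule AE_I2)
      fix z
      show "norm (\<phi> (x - z) * f z) \<le> norm (B * (indicator (cball 0 (norm x + r)) z *\<^sub>R f z))"
      proof (cases "norm z \<le> norm x + r")
        case True
        then show ?thesis using B'[of "x - z"] B(1) by (auto simp: abs_mult intro: mult_right_mono)
      next
        case False
        then have "r < norm (x - z)" using norm_triangle_ineq3[of x z] by linarith
        then show ?thesis using supp by simp
      qed
    qed
  qed measurable
qed

text \<open>The gradient of \<phi> is uniformly continuous, so the first-order remainder of \<phi>
  is at most e |v| uniformly in the base point. Integrating it against |f| over one fixed ball works
  for \<open>f\<close> merely locally integrable.\<close>

lemma convolution_has_derivative:
  fixes \<phi> f :: "'a::euclidean_space \<Rightarrow> real"
  assumes der: "\<And>z. (\<phi> has_derivative \<phi>' z) (at z)"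
    and cont: "\<And>b. b \<in> Basis \<Longrightarrow> continuous_on UNIV (\<lambda>z. \<phi>' z b)"
    and supp: "\<And>z. r < norm z \<Longrightarrow> \<phi> z = 0" and supp': "\<And>z v. r < norm z \<Longrightarrow> \<phi>' z v = 0"
    and [measurable]: "f \<in> borel_measurable borel" and f: "\<And>R. set_integrable lborel (cball 0 R) f"
  shows "((\<lambda>x. LINT z|lborel. \<phi> (x - z) * f z) has_derivative (\<lambda>v. LINT z|lborel. \<phi>' (x - z) v * f z)) (at x)"
proof -
  have lin: "linear (\<phi>' z)" for z using has_derivative_linear[OF der] .
  \<comment> \<open>The gradient: by Cauchy-Schwarz, its norm controls \<open>\<phi>' z v\<close>
    for all directions v at once.\<close>
  define \<Phi> where "\<Phi> z = (\<Sum>b\<in>Basis. \<phi>' z b *\<^sub>R b)" for z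
  have \<Phi>: "\<phi>' z v = \<Phi> z \<bullet> v" for z v
  proof -
    have "\<phi>' z v = \<phi>' z (\<Sum>b\<in>Basis. (v \<bullet> b) *\<^sub>R b)" by (simp add: euclidean_representation)
    also have "\<dots> = (\<Sum>b\<in>Basis. (v \<bullet> b) * \<phi>' z b)" by (simp add: linear_sum[OF lin] linear_scale[OF lin])
    also have "\<dots> = \<Phi> z \<bullet> v" by (simp add: \<Phi>_def inner_sum_left inner_commute[of v] mult.commute)
    finally show ?thesis .
  qed
  have cont\<Phi>: "continuous_on UNIV \<Phi>" unfolding \<Phi>_def by (intro continuous_intros cont)
  then have contv: "continuous_on UNIV (\<lambda>z. \<phi>' z v)" for v
    unfolding \<Phi> by (intro continuous_intros)
  have supp\<Phi>: "\<Phi> z = 0" if "r < norm z" for z using supp'[OF that] by (simp add: \<Phi>_def)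
  have cont\<phi>: "continuous_on UNIV \<phi>"
    using der by (auto intro!: continuous_at_imp_continuous_on has_derivative_continuous)
  have int: "integrable lborel (\<lambda>z. \<phi> (x - z) * f z)" for x
    using integrable_convolution[OF cont\<phi> supp _ f] by simp
  have int': "integrable lborel (\<lambda>z. \<phi>' (x - z) v * f z)" for x v
    using integrable_convolution[OF contv supp' _ f] by simp
  have rem: "\<exists>d>0. \<forall>z v. norm v < d \<longrightarrow> \<bar>\<phi> (z + v) - \<phi> z - \<phi>' z v\<bar> \<le> e * norm v" if "e > 0" for e
  proof -
    obtain d where d: "d > 0" "\<And>z z'. norm (z - z') < d \<Longrightarrow> norm (\<Phi> z - \<Phi> z') < e"
      using uniformly_continuous_compact_support[OF cont\<Phi> supp\<Phi> \<open>e > 0\<close>] by blast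
    have "\<bar>\<phi> (z + v) - \<phi> z - \<phi>' z v\<bar> \<le> e * norm v" if v: "norm v < d" for z v
    proof -
      have "norm (\<phi> (z + v) - \<phi> z - \<phi>' z ((z + v) - z)) \<le> norm ((z + v) - z) * e"
      proof (rule differentiable_bound_linearization[where S = "ball z d" and f' = \<phi>'])
        show "z + t *\<^sub>R (z + v - z) \<in> ball z d" if "t \<in> {0..1}" for t :: real
        proof -
          have "\<bar>t\<bar> * norm v \<le> 1 * norm v" using that by (intro mult_right_mono) auto
          then show ?thesis using v by (simp add: dist_norm)
        qed
        show "(\<phi> has_derivative \<phi>' y) (at y within ball z d)" for y
          by (rule has_derivative_at_withinI[OF der])
        show "onorm (\<phi>' y - \<phi>' z) \<le> e" if "y \<in> ball z d" for y
        proof (rule onorm_le)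
          fix u
          have "norm ((\<phi>' y - \<phi>' z) u) = \<bar>(\<Phi> y - \<Phi> z) \<bullet> u\<bar>" by (simp add: \<Phi> inner_diff_left)
          also have "\<dots> \<le> norm (\<Phi> y - \<Phi> z) * norm u" by (rule Cauchy_Schwarz_ineq2)
          also have "\<dots> \<le> e * norm u"
            using d(2)[of y z] that by (intro mult_right_mono) (auto simp: dist_norm norm_minus_commute)
          finally show "norm ((\<phi>' y - \<phi>' z) u) \<le> e * norm u" .
        qed
      qed (use d(1) in auto)
      then show ?thesis by (simp add: mult.commute)
    qed
    then show ?thesis using d(1) by blast
  qed
  show ?thesis unfolding has_derivative_at_alt
  proof (intro conjI allI impI)
    have "linear (\<lambda>v. LINT z|lborel. \<phi>' (x - z) v * f z)"
    proof (rule linearI)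
      fix u v
      show "(LINT z|lborel. \<phi>' (x - z) (u + v) * f z) = (LINT z|lborel. \<phi>' (x - z) u * f z) + (LINT z|lborel. \<phi>' (x - z) v * f z)"
        using int' by (simp add: linear_add[OF lin] distrib_right)
    next
      fix c v
      show "(LINT z|lborel. \<phi>' (x - z) (c *\<^sub>R v) * f z) = c *\<^sub>R (LINT z|lborel. \<phi>' (x - z) v * f z)"
        by (simp add: linear_scale[OF lin] mult.assoc)
    qed
    then show "bounded_linear (\<lambda>v. LINT z|lborel. \<phi>' (x - z) v * f z)"
      by (simp add: linear_conv_bounded_linear)
  next
    fix e :: real assume "e > 0"
    \<comment> \<open>Contains the supports of \<phi>(x - .) and of \<phi>(y - .) for every y within
      distance 1 of x.\<close>
    define K where "K = cball (0::'a) (norm x + r + 1)"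
    define I where "I = (LINT z|lborel. indicator K z * \<bar>f z\<bar>)"
    have intK: "integrable lborel (\<lambda>z. indicator K z * \<bar>f z\<bar>)"
      using integrable_abs[OF f[of "norm x + r + 1", unfolded set_integrable_def]] by (simp add: K_def abs_mult)
    have I: "I \<ge> 0" unfolding I_def by simp
    \<comment> \<open>The summand 1 keeps the divisor positive when I = 0 and still gives e' * I
      \<le> e.\<close>
    define e' where "e' = e / (I + 1)"
    have e': "e' > 0" "e' * I \<le> e" using I \<open>e > 0\<close> by (auto simp: e'_def field_simps)
    obtain d where d: "d > 0" "\<And>z v. norm v < d \<Longrightarrow> \<bar>\<phi> (z + v) - \<phi> z - \<phi>' z v\<bar> \<le> e' * norm v"
      using rem[OF e'(1)] by blast
    have "norm ((LINT z|lborel. \<phi> (y - z) * f z) - (LINT z|lborel. \<phi> (x - z) * f z)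
        - (LINT z|lborel. \<phi>' (x - z) (y - x) * f z)) \<le> e * norm (y - x)" if y: "norm (y - x) < min d 1" for y
    proof -
      let ?R = "\<lambda>z. \<phi> (y - z) - \<phi> (x - z) - \<phi>' (x - z) (y - x)"
      have intR: "integrable lborel (\<lambda>z. ?R z * f z)"
        using int int' by (simp add: left_diff_distrib)
      have "(LINT z|lborel. \<phi> (y - z) * f z) - (LINT z|lborel. \<phi> (x - z) * f z)
        - (LINT z|lborel. \<phi>' (x - z) (y - x) * f z) = (LINT z|lborel. ?R z * f z)"
        using int int' by (simp add: left_diff_distrib)
      also have "norm \<dots> \<le> (LINT z|lborel. \<bar>?R z * f z\<bar>)"
        using integral_abs_bound by simp
      also have "\<dots> \<le> (LINT z|lborel. (e' * norm (y - x)) * (indicator K z * \<bar>f z\<bar>))"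
      proof (rule integral_mono)
        fix z
        show "\<bar>?R z * f z\<bar> \<le> (e' * norm (y - x)) * (indicator K z * \<bar>f z\<bar>)"
        proof (cases "z \<in> K")
          case True
          then show ?thesis using d(2)[of "y - x" "x - z"] y by (auto simp: abs_mult intro: mult_right_mono)
        next
          case False
          then have "norm z > norm x + r + 1" by (simp add: K_def)
          then have "r < norm (x - z)" "r < norm (y - z)"
            using norm_triangle_ineq3[of x z] norm_triangle_ineq3[of y z] norm_triangle_ineq3[of y x] y by linarith+
          then show ?thesis using supp supp' e' by simp
        qed
      qed (use intR intK in auto)
      also have "\<dots> = (e' * I) * norm (y - x)" by (simp add: I_def)
      also have "\<dots> \<le> e * norm (y - x)" using e' by (intro mult_right_mono) auto
      finally show ?thesis .
    qed
    then show "\<exists>d>0. \<forall>y. norm (y - x) < d \<longrightarrow> norm ((LINT z|lborel. \<phi> (y - z) * f z) - (LINT z|lborel. \<phi> (x - z) * f z)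
        - (LINT z|lborel. \<phi>' (x - z) (y - x) * f z)) \<le> e * norm (y - x)"
      using d(1) by (intro exI[of _ "min d 1"]) auto
  qed
qed

lemma frechet_derivative_outside_support:
  fixes \<phi> :: "'a::euclidean_space \<Rightarrow> real"
  assumes supp: "\<And>z. r < norm z \<Longrightarrow> \<phi> z = 0" and z: "r < norm z"
  shows "frechet_derivative \<phi> (at z) v = 0"
proof -
  have "open {z::'a. r < norm z}" by (intro open_Collect_less continuous_intros)
  then have "(\<phi> has_derivative (\<lambda>_. 0)) (at z)"
    by (rule has_derivative_transform_within_open[OF has_derivative_const]) (use supp z in auto)
  then show ?thesis using frechet_derivative_at by metis
qed

text \<open>All derivatives fall on the kernel. The induction varies \<phi>, since its partial
  derivatives are again smooth and vanish outside the same radius.\<close>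

lemma cont_diff_convolution:
  fixes \<phi> f :: "'a::euclidean_space \<Rightarrow> real"
  assumes "\<And>k. cont_diff k \<phi>" and "\<And>z. r < norm z \<Longrightarrow> \<phi> z = 0"
    and f: "f \<in> borel_measurable borel" "\<And>R. set_integrable lborel (cball 0 R) f"
  shows "cont_diff k (\<lambda>x. LINT z|lborel. \<phi> (x - z) * f z)"
  using assms(1,2)
proof (induction k arbitrary: \<phi>)
  have smooth': "cont_diff k (\<lambda>z. frechet_derivative \<phi> (at z) b)"
    if "\<And>k. cont_diff k \<phi>" "b \<in> Basis" for \<phi> b k
    using that(1)[of "Suc k"] that(2) by simp
  have der: "((\<lambda>x. LINT z|lborel. \<phi> (x - z) * f z) has_derivative
      (\<lambda>v. LINT z|lborel. frechet_derivative \<phi> (at (x - z)) v * f z)) (at x)"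
    if "\<And>k. cont_diff k \<phi>" "\<And>z. r < norm z \<Longrightarrow> \<phi> z = 0" for \<phi> x
  proof (rule convolution_has_derivative[OF _ _ _ _ f])
    show "(\<phi> has_derivative frechet_derivative \<phi> (at z)) (at z)" for z
      using that(1) by (rule cont_diff_Suc_has_derivative)
    show "continuous_on UNIV (\<lambda>z. frechet_derivative \<phi> (at z) b)" if "b \<in> Basis" for b
      using smooth'[OF \<open>\<And>k. cont_diff k \<phi>\<close> that, of 0] by simp
    show "frechet_derivative \<phi> (at z) v = 0" if "r < norm z" for z v
      by (rule frechet_derivative_outside_support[OF \<open>\<And>z. r < norm z \<Longrightarrow> \<phi> z = 0\<close> that])
  qed (fact that(2))
  {
    case (0 \<phi>)
    then show ?case using der[OF 0]
      by (auto intro!: continuous_at_imp_continuous_on has_derivative_continuous)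
  next
    case (Suc k \<phi>)
    show ?case
    proof (rule cont_diff_SucI[OF der[OF Suc.prems]])
      fix b :: 'a assume b: "b \<in> Basis"
      show "cont_diff k (\<lambda>x. LINT z|lborel. frechet_derivative \<phi> (at (x - z)) b * f z)"
        by (rule Suc.IH[OF smooth'[OF Suc.prems(1) b] frechet_derivative_outside_support[OF Suc.prems(2)]])
    qed
  }
qed

section \<open>Energies with constant radius\<close>

lemma nn_integral_lborel_scale:
  fixes F :: "'a::euclidean_space \<Rightarrow> ennreal"
  assumes [measurable]: "F \<in> borel_measurable borel" and "c \<noteq> 0"
  shows "(\<integral>\<^sup>+x. F x \<partial>lborel) = ennreal (\<bar>c\<bar> ^ DIM('a)) * (\<integral>\<^sup>+x. F (c *\<^sub>R x) \<partial>lborel)"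
proof -
  have "(\<integral>\<^sup>+x. F x \<partial>lborel) =
      (\<integral>\<^sup>+x. F x \<partial>density (distr lborel borel (\<lambda>x::'a. 0 + c *\<^sub>R x)) (\<lambda>_. \<bar>c\<bar> ^ DIM('a)))"
    using lborel_affine[OF \<open>c \<noteq> 0\<close>, of "0 :: 'a"] by simp
  also have "\<dots> = (\<integral>\<^sup>+x. ennreal (\<bar>c\<bar> ^ DIM('a)) * F (c *\<^sub>R x) \<partial>lborel)"
    by (subst nn_integral_density) (simp_all add: nn_integral_distr)
  finally show ?thesis by (simp add: nn_integral_cmult)
qed

text \<open>The exponent \<alpha> will be s p + N. At h = 0 the quotient is 1 / 0 = 0, in agreement
  with the integrand of \<open>screened_energy\<close>.\<close>

definition ball_kernel :: "real \<Rightarrow> real \<Rightarrow> 'a::euclidean_space \<Rightarrow> real" where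
  "ball_kernel \<alpha> r h = (if norm h < r then 1 / norm h powr \<alpha> else 0)"

lemma ball_kernel_nonneg: "0 \<le> ball_kernel \<alpha> r h"
  by (simp add: ball_kernel_def)

lemma borel_measurable_ball_kernel [measurable]: "ball_kernel \<alpha> r \<in> borel_measurable borel"
  unfolding ball_kernel_def by measurable

lemma ball_kernel_double_le:
  assumes "0 \<le> \<alpha>"
  shows "ball_kernel \<alpha> (2 * r) (2 *\<^sub>R h) \<le> ball_kernel \<alpha> r h"
proof -
  have "norm h powr \<alpha> \<le> norm (2 *\<^sub>R h) powr \<alpha>"
    using assms by (intro powr_mono2) auto
  then have "1 / norm (2 *\<^sub>R h) powr \<alpha> \<le> 1 / norm h powr \<alpha>"
    by (cases "h = 0") (simp_all add: frac_le)
  then show ?thesis by (simp add: ball_kernel_def)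
qed

lemma difference_energy_swap:
  fixes w f :: "'a::euclidean_space \<Rightarrow> real"
  assumes w: "\<And>h. 0 \<le> w h" and [measurable]: "w \<in> borel_measurable borel" "f \<in> borel_measurable borel"
  shows "difference_energy w p f =
    (\<integral>\<^sup>+h. ennreal (w h) * (\<integral>\<^sup>+x. ennreal (\<bar>f (x + h) - f x\<bar> powr p) \<partial>lborel) \<partial>lborel)"
proof -
  have "difference_energy w p f =
      (\<integral>\<^sup>+h. (\<integral>\<^sup>+x. ennreal (w h * \<bar>f (x + h) - f x\<bar> powr p) \<partial>lborel) \<partial>lborel)"
    unfolding difference_energy_def by (intro lborel_pair.Fubini') measurable
  then show ?thesis using w by (simp add: ennreal_mult nn_integral_cmult)
qed

text \<open>After integrating in x for fixed h, the increment starting at x + h contributes as much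
  as the one starting at x, so \<open>A (2 *\<^sub>R h)\<close> is at most 2 * 2^p times
  \<open>A h\<close>. Substituting 2h for h costs the Jacobian 2^N, and the kernel does not
  grow.\<close>

lemma difference_energy_double:
  fixes f :: "'a::euclidean_space \<Rightarrow> real"
  assumes p: "1 \<le> p" and \<alpha>: "0 \<le> \<alpha>" and [measurable]: "f \<in> borel_measurable borel"
    and fin: "difference_energy (ball_kernel \<alpha> r) p f < \<infinity>"
  shows "difference_energy (ball_kernel \<alpha> (2 * r)) p f < \<infinity>"
proof -
  define A where "A h = (\<integral>\<^sup>+x. ennreal (\<bar>f (x + h) - f x\<bar> powr p) \<partial>lborel)" for h
  have [measurable]: "A \<in> borel_measurable borel" unfolding A_def by measurable
  have A2: "A (2 *\<^sub>R h) \<le> ennreal (2 * 2 powr p) * A h" for h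
  proof -
    have pt: "ennreal (\<bar>f (x + 2 *\<^sub>R h) - f x\<bar> powr p) \<le>
        ennreal (2 powr p) * (ennreal (\<bar>f ((x + h) + h) - f (x + h)\<bar> powr p) + ennreal (\<bar>f (x + h) - f x\<bar> powr p))" for x
    proof -
      have eq: "x + 2 *\<^sub>R h = (x + h) + h" by (simp add: scaleR_2)
      have "\<bar>f (x + 2 *\<^sub>R h) - f x\<bar> powr p \<le> (\<bar>f ((x + h) + h) - f (x + h)\<bar> + \<bar>f (x + h) - f x\<bar>) powr p"
        unfolding eq using p by (intro powr_mono2) auto
      also have "\<dots> \<le> 2 powr p * (\<bar>f ((x + h) + h) - f (x + h)\<bar> powr p + \<bar>f (x + h) - f x\<bar> powr p)"
        using p by (intro powr_add_le) auto
      finally show ?thesis by (simp add: ennreal_mult[symmetric] ennreal_plus[symmetric] ennreal_leI del: ennreal_plus)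
    qed
    have "A (2 *\<^sub>R h) \<le> (\<integral>\<^sup>+x. ennreal (2 powr p) * (ennreal (\<bar>f ((x + h) + h) - f (x + h)\<bar> powr p) + ennreal (\<bar>f (x + h) - f x\<bar> powr p)) \<partial>lborel)"
      unfolding A_def by (intro nn_integral_mono pt)
    also have "\<dots> = ennreal (2 powr p) * ((\<integral>\<^sup>+x. ennreal (\<bar>f ((x + h) + h) - f (x + h)\<bar> powr p) \<partial>lborel) + A h)"
      unfolding A_def by (simp add: nn_integral_cmult nn_integral_add)
    also have "(\<integral>\<^sup>+x. ennreal (\<bar>f ((x + h) + h) - f (x + h)\<bar> powr p) \<partial>lborel) = A h"
      unfolding A_def by (rule nn_integral_lborel_translate[of "\<lambda>x. ennreal (\<bar>f (x + h) - f x\<bar> powr p)"]) measurable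
    also have "ennreal (2 powr p) * (A h + A h) = ennreal (2 * 2 powr p) * A h"
      by (simp add: ennreal_mult mult_2[symmetric] ac_simps)
    finally show ?thesis .
  qed
  have "difference_energy (ball_kernel \<alpha> (2 * r)) p f = (\<integral>\<^sup>+h. ennreal (ball_kernel \<alpha> (2 * r) h) * A h \<partial>lborel)"
    unfolding A_def by (intro difference_energy_swap ball_kernel_nonneg) measurable
  also have "\<dots> = ennreal (\<bar>2\<bar> ^ DIM('a)) * (\<integral>\<^sup>+h. ennreal (ball_kernel \<alpha> (2 * r) (2 *\<^sub>R h)) * A (2 *\<^sub>R h) \<partial>lborel)"
    by (rule nn_integral_lborel_scale) auto
  also have "\<dots> \<le> ennreal (\<bar>2\<bar> ^ DIM('a)) * (\<integral>\<^sup>+h. ennreal (ball_kernel \<alpha> r h) * (ennreal (2 * 2 powr p) * A h) \<partial>lborel)"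
    by (intro mult_left_mono nn_integral_mono mult_mono A2 ennreal_leI ball_kernel_double_le \<alpha>) auto
  also have "(\<integral>\<^sup>+h. ennreal (ball_kernel \<alpha> r h) * (ennreal (2 * 2 powr p) * A h) \<partial>lborel)
      = ennreal (2 * 2 powr p) * (\<integral>\<^sup>+h. ennreal (ball_kernel \<alpha> r h) * A h \<partial>lborel)"
    by (subst nn_integral_cmult[symmetric]) (auto simp: ac_simps)
  also have "(\<integral>\<^sup>+h. ennreal (ball_kernel \<alpha> r h) * A h \<partial>lborel) = difference_energy (ball_kernel \<alpha> r) p f"
    unfolding A_def by (intro difference_energy_swap[symmetric] ball_kernel_nonneg) measurable
  also have "ennreal (\<bar>2\<bar> ^ DIM('a)) * (ennreal (2 * 2 powr p) * difference_energy (ball_kernel \<alpha> r) p f) < \<infinity>"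
    using fin by (simp add: ennreal_mult_less_top)
  finally show ?thesis .
qed

lemma difference_energy_mono:
  assumes "\<And>h. w h \<le> w' h"
  shows "difference_energy w p f \<le> difference_energy w' p f"
  unfolding difference_energy_def by (intro nn_integral_mono ennreal_leI mult_right_mono assms) auto

text \<open>Iterated doubling reaches a radius 2^n a at least b, and the kernel increases with its
  radius.\<close>

lemma difference_energy_ball_kernel_finite:
  fixes f :: "'a::euclidean_space \<Rightarrow> real"
  assumes p: "1 \<le> p" and \<alpha>: "0 \<le> \<alpha>" and f: "f \<in> borel_measurable borel"
    and fin: "difference_energy (ball_kernel \<alpha> a) p f < \<infinity>" and a: "0 < a"
  shows "difference_energy (ball_kernel \<alpha> b) p f < \<infinity>"
proof -
  have pow: "difference_energy (ball_kernel \<alpha> (2 ^ n * a)) p f < \<infinity>" for n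
  proof (induction n)
    case (Suc n)
    then show ?case using difference_energy_double[OF p \<alpha> f Suc] by (simp add: mult.assoc)
  qed (use fin in simp)
  obtain n :: nat where "b / a < 2 ^ n" using real_arch_pow[of 2 "b / a"] by auto
  then have n: "b \<le> 2 ^ n * a" using a by (simp add: field_simps)
  have "difference_energy (ball_kernel \<alpha> b) p f \<le> difference_energy (ball_kernel \<alpha> (2 ^ n * a)) p f"
    by (rule difference_energy_mono)
      (use n in \<open>auto simp: ball_kernel_def split: split_indicator\<close>)
  then show ?thesis using pow[of n] by (rule order.strict_trans1)
qed

lemma screened_energy_le:
  fixes f :: "'a::euclidean_space \<Rightarrow> real"
  assumes "\<And>x. \<sigma> x \<le> ennreal b"
  shows "screened_energy \<sigma> s p f \<le> difference_energy (ball_kernel (s * p + real DIM('a)) b) p f"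
  \<comment> \<open>\<open>nn_integral_completion\<close> holds for every integrand, so here and in
    the lower bound the passage to \<open>lborel\<close> leaves a pointwise comparison of
    kernels.\<close>
  unfolding screened_energy_def difference_energy_def nn_integral_completion
proof (intro nn_integral_mono)
  fix x h :: 'a
  have "norm h < b" if "ennreal (norm h) < \<sigma> x"
    using order.strict_trans2[OF that assms] by (simp add: ennreal_less_iff)
  then show "ennreal (\<bar>f (x + h) - f x\<bar> powr p / norm h powr (s * p + real DIM('a))) *
      indicator {h. ennreal (norm h) < \<sigma> x} h
      \<le> ennreal (ball_kernel (s * p + real DIM('a)) b h * \<bar>f (x + h) - f x\<bar> powr p)"
    by (auto simp: ball_kernel_def split: split_indicator)
qed

lemma screened_energy_ge:
  fixes f :: "'a::euclidean_space \<Rightarrow> real"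
  assumes "\<And>x. ennreal a \<le> \<sigma> x"
  shows "difference_energy (ball_kernel (s * p + real DIM('a)) a) p f \<le> screened_energy \<sigma> s p f"
  unfolding screened_energy_def difference_energy_def nn_integral_completion
proof (intro nn_integral_mono)
  fix x h :: 'a
  have "ennreal (norm h) < \<sigma> x" if "norm h < a"
    using order.strict_trans2[OF _ assms[of x], of "ennreal (norm h)"] that by (simp add: ennreal_less_iff)
  then show "ennreal (ball_kernel (s * p + real DIM('a)) a h * \<bar>f (x + h) - f x\<bar> powr p)
      \<le> ennreal (\<bar>f (x + h) - f x\<bar> powr p / norm h powr (s * p + real DIM('a))) *
      indicator {h. ennreal (norm h) < \<sigma> x} h"
    by (auto simp: ball_kernel_def split: split_indicator)
qed

lemma screened_energy_cong_AE:
  assumes "AE x in lebesgue. f x = g x"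
  shows "screened_energy \<sigma> s p f = screened_energy \<sigma> s p g"
  unfolding screened_energy_def
proof (rule nn_integral_cong_AE, use assms in eventually_elim)
  case (elim x)
  have "AE h in lebesgue. f (x + h) = g (x + h)"
    using assms by (rule AE_lebesgue_translate)
  then show ?case
    by (intro nn_integral_cong_AE) (use elim in \<open>auto elim!: eventually_mono\<close>)
qed

section \<open>Borel representatives and smooth approximation\<close>

lemma L1_loc_borel_representative:
  fixes f :: "'a::euclidean_space \<Rightarrow> real"
  assumes f: "f \<in> L1_loc"
  obtains f' where "f' \<in> borel_measurable borel" "AE x in lebesgue. f x = f' x"
    "\<And>R. set_integrable lborel (cball 0 R) f'"
proof -
  have int: "integrable lebesgue (\<lambda>x. indicator (cball 0 R) x *\<^sub>R f x)" for R
    using f by (auto simp: L1_loc_def set_integrable_def)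
  \<comment> \<open>Local integrability makes each truncation to a ball measurable, and
    \<open>f\<close> is their pointwise limit.\<close>
  have "f \<in> borel_measurable lebesgue"
  proof (rule borel_measurable_LIMSEQ_real)
    show "(\<lambda>n. indicator (cball 0 (real n)) x *\<^sub>R f x) \<longlonglongrightarrow> f x" for x
    proof (rule tendsto_eventually)
      obtain N :: nat where "norm x \<le> real N" using real_arch_simple by blast
      then have "\<forall>n\<ge>N. x \<in> cball 0 (real n)" by auto
      then show "\<forall>\<^sub>F n in sequentially. indicator (cball 0 (real n)) x *\<^sub>R f x = f x"
        by (auto simp: eventually_sequentially intro!: exI[of _ N])
    qed
    show "(\<lambda>x. indicator (cball 0 (real n)) x *\<^sub>R f x) \<in> borel_measurable lebesgue" for n
      using int by (rule borel_measurable_integrable)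
  qed
  then obtain f' where f': "f' \<in> borel_measurable lborel" "AE x in lborel. f x = f' x"
    using completion_ex_borel_measurable_real by blast
  have ae: "AE x in lebesgue. f x = f' x" using f'(2) by (rule AE_completion)
  have "set_integrable lborel (cball 0 R) f'" for R
  proof -
    have m: "(\<lambda>x. indicator (cball 0 R) x *\<^sub>R f' x) \<in> borel_measurable lborel"
      using f'(1) by (intro borel_measurable_scaleR borel_measurable_indicator) auto
    have "integrable lebesgue (\<lambda>x. indicator (cball 0 R) x *\<^sub>R f' x)"
    proof (subst integrable_cong_AE[symmetric])
      show "AE x in lebesgue. indicator (cball 0 R) x *\<^sub>R f x = indicator (cball 0 R) x *\<^sub>R f' x"
        using ae by eventually_elim simp
    qed (use int[of R] m measurable_completion[OF m] in auto)
    then show ?thesis unfolding set_integrable_def using integrable_completion[OF m] by simp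
  qed
  then show ?thesis using that f'(1) ae by simp
qed

lemma continuous_imp_L1_loc: "continuous_on UNIV f \<Longrightarrow> f \<in> L1_loc"
  unfolding L1_loc_def set_integrable_def
proof (intro CollectI allI impI)
  fix K :: "'a set" assume f: "continuous_on UNIV f" and K: "compact K"
  have "integrable lborel (\<lambda>x. indicator K x *\<^sub>R f x)"
    using K by (rule borel_integrable_compact) (rule continuous_on_subset[OF f], simp)
  then show "integrable lebesgue (\<lambda>x. indicator K x *\<^sub>R f x)"
    by (subst integrable_completion) (auto dest: borel_measurable_integrable)
qed

lemma smooth_approximation:
  fixes f :: "'a::euclidean_space \<Rightarrow> real"
  assumes p: "1 \<le> p" and s: "0 < s" and a: "0 < a" "\<And>x. ennreal a \<le> \<sigma> x" and b: "\<And>x. \<sigma> x \<le> ennreal b"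
    and f: "f \<in> screened_space \<sigma> s p" and e: "0 < e"
  shows "\<exists>g \<in> smooth_functions \<inter> screened_space \<sigma> s p. screened_seminorm \<sigma> s p (\<lambda>x. f x - g x) < e"
proof -
  define \<alpha> where "\<alpha> = s * p + real DIM('a)"
  have \<alpha>: "0 \<le> \<alpha>" using s p by (simp add: \<alpha>_def)
  let ?E = "difference_energy (ball_kernel \<alpha> b) p :: ('a \<Rightarrow> real) \<Rightarrow> ennreal"
  have upper: "screened_energy \<sigma> s p g \<le> ?E g" for g :: "'a \<Rightarrow> real"
    unfolding \<alpha>_def by (rule screened_energy_le[OF b])
  from f have "f \<in> L1_loc" and fin: "screened_energy \<sigma> s p f < \<infinity>" by (auto simp: screened_space_def)
  \<comment> \<open>The mollification is carried out on a Borel representative so that Tonelli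
    applies on the product; energies do not see the change.\<close>
  obtain F where [measurable]: "F \<in> borel_measurable borel" and ae: "AE x in lebesgue. f x = F x"
    and loc: "\<And>R. set_integrable lborel (cball 0 R) F"
    using L1_loc_borel_representative[OF \<open>f \<in> L1_loc\<close>] by blast
  have "difference_energy (ball_kernel \<alpha> a) p F \<le> screened_energy \<sigma> s p f"
    unfolding screened_energy_cong_AE[OF ae] \<alpha>_def by (rule screened_energy_ge[OF a(2)])
  then have "difference_energy (ball_kernel \<alpha> a) p F < \<infinity>" using fin by (rule order.strict_trans1)
  from difference_energy_ball_kernel_finite[OF p \<alpha> \<open>F \<in> borel_measurable borel\<close> this a(1)]
  have finF: "?E F < \<infinity>" .
  \<comment> \<open>The p-th root of \<delta> is e / 2; halving restores the strict inequality,
    since mollification yields only \<le>.\<close>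
  define \<delta> where "\<delta> = (e / 2) powr p"
  have "0 < ennreal \<delta>" using e by (simp add: \<delta>_def)
  then obtain d where d: "d > 0" "\<And>y. norm y < d \<Longrightarrow> ?E (\<lambda>x. F x - F (x + y)) < ennreal \<delta>"
    using difference_energy_translate_small[OF p ball_kernel_nonneg borel_measurable_ball_kernel
        \<open>F \<in> borel_measurable borel\<close> finF] by blast
  obtain \<eta> :: "'a \<Rightarrow> real" where smooth: "\<And>k. cont_diff k \<eta>" and \<eta>0: "\<And>y. 0 \<le> \<eta> y"
    and supp: "\<And>y. d \<le> norm y \<Longrightarrow> \<eta> y = 0" and even: "\<And>y. \<eta> (- y) = \<eta> y"
    and \<eta>1: "integrable lborel \<eta>" "(LINT y|lborel. \<eta> y) = 1"
    using ex_mollifier[OF d(1)] by blast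
  define g where "g x = (LINT z|lborel. \<eta> (x - z) * F z)" for x
  have g_cont_diff: "cont_diff k g" for k
    unfolding g_def by (rule cont_diff_convolution[OF smooth, of d]) (use supp loc in auto)
  then have g_smooth: "g \<in> smooth_functions" by (simp add: smooth_functions_def)
  have "continuous_on UNIV g" using g_cont_diff[of 0] by simp
  then have [measurable]: "g \<in> borel_measurable borel" by (intro borel_measurable_continuous_onI)
  have int: "integrable lborel (\<lambda>z. \<eta> (z - x) * F z)" for x
  proof -
    have "integrable lborel (\<lambda>z. \<eta> (x - z) * F z)"
      by (rule integrable_convolution[of _ d]) (use smooth[of 0] supp loc in auto)
    then show ?thesis using even[of "_ - x"] by simp
  qed
  have int': "integrable lborel (\<lambda>y. \<eta> y * F (x + y))" for x
    using integrable_lborel_translate[OF int[of x], of x] by (simp add: add.commute)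
  \<comment> \<open>Substituting z = x + y and using evenness turns the convolution, the form suited
    to differentiation, into an average of translates, the form suited to the energy
    estimate.\<close>
  have g_eq: "g x = (LINT y|lborel. \<eta> y * F (x + y))" for x
    using integral_lborel_translate[OF int[of x], of x] even[of "_ - x"]
    by (simp add: g_def add.commute)
  have E: "?E (\<lambda>x. F x - g x) \<le> ennreal \<delta>"
    unfolding g_eq
  proof (rule difference_energy_mollify[OF p ball_kernel_nonneg _ _ \<eta>0 \<eta>1 int'])
    show "?E (\<lambda>x. F x - F (x + y)) \<le> ennreal \<delta>" if "\<eta> y \<noteq> 0" for y
      using d(2)[of y] supp[of y] that by (meson less_imp_le not_le)
  qed measurable
  \<comment> \<open>Finite energy of g comes from that of F and of the error F - g.\<close>
  have "?E g = ?E (\<lambda>x. F x - (F x - g x))" by simp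
  also have "\<dots> \<le> ennreal (2 powr p) * (?E F + ?E (\<lambda>x. F x - g x))"
    by (intro difference_energy_triangle p ball_kernel_nonneg) measurable
  also have "\<dots> < \<infinity>"
    using finF order.strict_trans1[OF E ennreal_less_top] by (simp add: ennreal_mult_less_top)
  finally have "?E g < \<infinity>" .
  then have "screened_energy \<sigma> s p g < \<infinity>" using upper by (rule order.strict_trans1[rotated])
  then have g: "g \<in> screened_space \<sigma> s p"
    using continuous_imp_L1_loc[OF \<open>continuous_on UNIV g\<close>] by (simp add: screened_space_def)
  have "AE x in lebesgue. (f x - g x) - (F x - g x) = 0" using ae by eventually_elim simp
  then have "screened_seminorm \<sigma> s p (\<lambda>x. f x - g x) = screened_seminorm \<sigma> s p (\<lambda>x. F x - g x)"
    by (rule screened_seminorm_cong_const)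
  also have "\<dots> \<le> \<delta> powr (1 / p)"
    unfolding screened_seminorm_def
  proof (rule powr_mono2)
    have "screened_energy \<sigma> s p (\<lambda>x. F x - g x) \<le> ennreal \<delta>" using upper E by (rule order.trans)
    then show "enn2real (screened_energy \<sigma> s p (\<lambda>x. F x - g x)) \<le> \<delta>"
      by (simp add: enn2real_leI \<delta>_def)
  qed (use p in auto)
  also have "\<dots> = e / 2" using p e by (simp add: \<delta>_def powr_powr)
  also have "\<dots> < e" using e by simp
  finally show ?thesis using g g_smooth by blast
qed

section \<open>Density in the space and in the quotient\<close>

lemma pseudometric_topology_closure_of_eq:
  assumes "S \<subseteq> M" and "\<And>x e. x \<in> M \<Longrightarrow> 0 < e \<Longrightarrow> \<exists>y\<in>S. d x y < e"
  shows "pseudometric_topology M d closure_of S = M"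
proof
  show "pseudometric_topology M d closure_of S \<subseteq> M"
    using closure_of_subset_topspace[of "pseudometric_topology M d" S] by simp
  show "M \<subseteq> pseudometric_topology M d closure_of S"
  proof
    fix x assume x: "x \<in> M"
    have "\<exists>y\<in>S. y \<in> T" if T: "x \<in> T" "openin (pseudometric_topology M d) T" for T
    proof -
      \<comment> \<open>Openness of T supplies a d-ball about x inside T directly, so any point of S
        in that ball is a witness. The same argument serves the seminorm and the quotient
        distance.\<close>
      obtain e where e: "e > 0" "\<forall>y\<in>M. d x y < e \<longrightarrow> y \<in> T"
        using T by (auto simp: openin_pseudometric_topology)
      obtain y where "y \<in> S" "d x y < e" using assms(2)[OF x e(1)] by blast
      then show ?thesis using e(2) assms(1) by blast
    qed
    then show "x \<in> pseudometric_topology M d closure_of S"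
      using x by (auto simp: in_closure_of)
  qed
qed

theorem theorem3p17:
  fixes \<sigma> :: "real ^ 'n \<Rightarrow> ennreal" and s p :: real
  assumes "1 \<le> p" and "0 < s" and "s < 1"
    and "screening_function \<sigma>" and "\<And>x. \<sigma> x < \<infinity>"
    and "0 < (INF x. \<sigma> x)" and "(SUP x. \<sigma> x) < \<infinity>"
  shows "screened_topology \<sigma> s p closure_of (smooth_functions \<inter> screened_space \<sigma> s p) =
           screened_space \<sigma> s p \<and>
         quotient_topology \<sigma> s p closure_of
           ((smooth_functions \<inter> screened_space \<sigma> s p) // const_rel \<sigma> s p) =
           screened_space \<sigma> s p // const_rel \<sigma> s p"
proof -
  let ?M = "screened_space \<sigma> s p" and ?S = "smooth_functions \<inter> screened_space \<sigma> s p"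
  let ?a = "enn2real (INF x. \<sigma> x)" and ?b = "enn2real (SUP x. \<sigma> x)"
  \<comment> \<open>The value of \<sigma> at an arbitrary point bounds the infimum, so
    \<open>enn2real\<close> does not collapse it to the default 0.\<close>
  have inf_fin: "(INF x. \<sigma> x) < \<infinity>"
    using INF_lower[of undefined UNIV \<sigma>] assms(5)[of undefined] by (simp add: order.strict_trans1)
  have a: "0 < ?a" using assms(6) inf_fin by (simp add: enn2real_positive_iff)
  have a': "ennreal ?a \<le> \<sigma> x" for x using inf_fin INF_lower[of x UNIV \<sigma>] by simp
  have b: "\<sigma> x \<le> ennreal ?b" for x using assms(7) SUP_upper[of x UNIV \<sigma>] by simp
  have approx: "\<exists>g\<in>?S. screened_seminorm \<sigma> s p (\<lambda>x. f x - g x) < e" if "f \<in> ?M" "0 < e" for f e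
    using assms(1,2) a a' b that by (rule smooth_approximation)
  have "screened_topology \<sigma> s p closure_of ?S = ?M"
    unfolding screened_topology_def by (rule pseudometric_topology_closure_of_eq) (use approx in auto)
  moreover have "quotient_topology \<sigma> s p closure_of (?S // const_rel \<sigma> s p) = ?M // const_rel \<sigma> s p"
    unfolding quotient_topology_def
  proof (rule pseudometric_topology_closure_of_eq)
    \<comment> \<open>The classes on the left are full classes of the whole space that have a smooth
      representative.\<close>
    show "?S // const_rel \<sigma> s p \<subseteq> ?M // const_rel \<sigma> s p" by (auto simp: quotient_def)
    fix X e assume "X \<in> ?M // const_rel \<sigma> s p" "0 < (e::real)"
    then obtain f where f: "f \<in> ?M" "X = const_rel \<sigma> s p `` {f}" by (auto elim: quotientE)
    obtain g where g: "g \<in> ?S" "screened_seminorm \<sigma> s p (\<lambda>x. f x - g x) < e"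
      using approx[OF f(1) \<open>0 < e\<close>] by blast
    \<comment> \<open>The class of the smooth approximant g works, because the distance of two
      classes is the seminorm of the difference of any representatives.\<close>
    then show "\<exists>Y\<in>?S // const_rel \<sigma> s p. quotient_norm \<sigma> s p (class_diff X Y) < e"
      using quotient_norm_class_diff[of f \<sigma> s p g] f
      by (intro bexI[of _ "const_rel \<sigma> s p `` {g}"]) (auto intro: quotientI)
  qed
  ultimately show ?thesis ..
qed

end
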